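(* Let $ZW_2 = \mathbf{Z}\wr(\mathbf{Z}\times\mathbf{Z})$ be the standard restricted wreath product. Then $ZW_2$ does not embed in R. Thompson's group $T$; that is, there is no injective group homomorphism $ZW_2\to T$.
   Context: The standard restricted wreath product $C\wr T_0$ of groups $C$ (bottom group) and $T_0$ (top group) is the semidirect product $B\rtimes T_0$, where $B=\bigoplus_{t\in T_0}C$ (the base group), with multiplication $((a_t)_{t\in T_0},r)\cdot((b_t)_{t\in T_0},s)=((c_t)_{t\in T_0},rs)$, where $c_t=a_t\,b_{t\cdot r}$ for each $t\in T_0$. R. Thompson's group $T$ is the group (under composition) of orientation-preserving piecewise-linear homeomorphisms of the circle $\mathbf{R}/\mathbf{Z}$ that map dyadic rationals to dyadic rationals, are differentiable except at finitely many points, all of which are dyadic rationals, and whose derivatives, where they exist, are integer powers of $2$. *)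

theory Defs
  imports "HOL-Analysis.Analysis" "HOL-Algebra.Product_Groups"
begin

definition wreath ::
    "('c, 'm) monoid_scheme \<Rightarrow> ('t, 'n) monoid_scheme \<Rightarrow> (('t \<Rightarrow> 'c) \<times> 't) monoid" where
  "wreath C T\<^sub>0 =
     \<lparr>carrier = carrier (sum_group (carrier T\<^sub>0) (\<lambda>_. C)) \<times> carrier T\<^sub>0,
      monoid.mult = (\<lambda>(a, r) (b, s).
        (\<lambda>t\<in>carrier T\<^sub>0. a t \<otimes>\<^bsub>C\<^esub> b (t \<otimes>\<^bsub>T\<^sub>0\<^esub> r), r \<otimes>\<^bsub>T\<^sub>0\<^esub> s)),
      one = (\<one>\<^bsub>sum_group (carrier T\<^sub>0) (\<lambda>_. C)\<^esub>, \<one>\<^bsub>T\<^sub>0\<^esub>)\<rparr>"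

definition ZW2 :: "((int \<times> int \<Rightarrow> int) \<times> (int \<times> int)) monoid" where
  "ZW2 = wreath integer_group (integer_group \<times>\<times> integer_group)"

quotient_type circle = real / "\<lambda>x y :: real. x - y \<in> \<int>"
  morphisms rep_circle to_circle
proof (rule equivpI)
  show "reflp (\<lambda>x y :: real. x - y \<in> \<int>)" by (simp add: reflp_def)
  show "symp (\<lambda>x y :: real. x - y \<in> \<int>)"
    by (rule sympI) (drule Ints_minus, simp)
  show "transp (\<lambda>x y :: real. x - y \<in> \<int>)"
    by (rule transpI) (drule (1) Ints_add, simp)
qed

instantiation circle :: topological_space
begin

definition open_circle :: "circle set \<Rightarrow> bool" where
  "open_circle U \<longleftrightarrow> open (to_circle -` U)"

instance
  by standard (auto simp: open_circle_def vimage_Union intro: open_Int)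

end

definition dyadic :: "real set" where
  "dyadic = {of_int k / 2 ^ n | (k :: int) (n :: nat). True}"

text \<open>
  Orientation, linearity and derivatives of a circle map are those of its lifts to the real line.
  Two continuous lifts of one map differ by an integer constant, so these notions do not depend
  on the lift.
\<close>

definition is_lift :: "(real \<Rightarrow> real) \<Rightarrow> (circle \<Rightarrow> circle) \<Rightarrow> bool" where
  "is_lift F f \<longleftrightarrow> continuous_on UNIV F \<and> (\<forall>x. f (to_circle x) = to_circle (F x))"

definition piecewise_linear :: "(real \<Rightarrow> real) \<Rightarrow> bool" where
  "piecewise_linear F \<longleftrightarrow>
     (\<exists>S :: circle set. finite S \<and>
        (\<forall>a b. to_circle ` {a<..<b} \<inter> S = {} \<longrightarrow>
           (\<exists>m c. \<forall>x\<in>{a<..<b}. F x = m * x + c)))"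

definition thompson_T :: "(circle \<Rightarrow> circle) monoid" where
  "thompson_T =
     \<lparr>carrier = {f. (\<exists>g. homeomorphism UNIV UNIV f g) \<and>
        f ` to_circle ` dyadic \<subseteq> to_circle ` dyadic \<and>
        (\<exists>F. is_lift F f \<and> strict_mono F \<and> piecewise_linear F \<and>
           finite (to_circle ` {x. \<not> F differentiable (at x)}) \<and>
           {x. \<not> F differentiable (at x)} \<subseteq> dyadic \<and>
           (\<forall>x d. (F has_real_derivative d) (at x) \<longrightarrow> (\<exists>k :: int. d = 2 powi k)))},
      monoid.mult = (\<circ>),
      one = id\<rparr>"

end

theory Submission
  imports Defs
begin

text \<open>
  Suppose \<open>\<int> \<wr> (\<int> \<times> \<int>)\<close> acts faithfully through Thompson's group \<open>T\<close>. The proof looks at germs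
  to the right of fixed points. Near a fixed point an element of \<open>T\<close> is affine with slope \<open>2\<^sup>k\<close>, so
  right germs at a fixed point commute, and an element of slope 1 is trivial there. Call a fixed
  point of \<open>f\<close> a departure of \<open>f\<close> if \<open>f\<close> moves points arbitrarily close to its right. An element with
  a fixed point has only finitely many departures, and a commuting element which also has a fixed
  point permutes them, hence fixes them (\<open>commuting_fixes_departures\<close>).

  Some powers \<open>s\<close> and \<open>t\<close> of the two generators of the top group have fixed points. If \<open>s\<close> moves \<open>p\<close>,
  the iterates of \<open>s\<close> or of its inverse push \<open>p\<close> towards a departure \<open>c\<close> of \<open>s\<close>. If the slopes at
  \<open>c\<close> are \<open>2\<^sup>i\<close> for \<open>s\<close> and \<open>2\<^sup>j\<close> for \<open>t\<close>, then \<open>s\<^sup>jt\<^sup>-\<^sup>i\<close> is trivial to the right of \<open>c\<close>, and as it commutes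
  with \<open>s\<close>, it fixes \<open>p\<close>. So there is a finite set \<open>W\<close> of nontrivial elements of the top group such
  that every point of the circle is fixed by one of them (\<open>finite_stabilizer_cover\<close>).

  The elements of the base group that have fixed points all fix each other's departures. Start
  with a nontrivial element of this kind and take successively the commutators with the elements
  of \<open>W\<close>. The result is nontrivial, because a nonzero finitely supported function on \<open>\<int> \<times> \<int>\<close> is
  not invariant under any nonzero translation. But each commutator with \<open>w\<close> has slope 1 at the common fixed
  points that \<open>w\<close> fixes, so the final element has a trivial right germ at all common fixed points,
  in particular at its own departures (\<open>exists_quiet\<close>). This is absurd.

  That some power of every element of \<open>T\<close> has a fixed point is proved by a variant of
  Denjoy's argument (\<open>no_aperiodic_lift\<close>). If there is no periodic point, the orbit \<open>x\<^sub>i\<close>, \<open>i \<in> \<int>\<close>, of 0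
  consists of distinct dyadic points of the circle, so the binary logarithms \<open>d\<^sub>i\<close> of their denominators
  tend to infinity in both directions of time. When \<open>d\<^sub>i\<close> is large, the slope at \<open>x\<^sub>i\<close> has binary logarithm
  \<open>d\<^sub>i - d\<^sub>i\<^sub>+\<^sub>1\<close>. So the iterates contract at 0 both forwards and backwards. However, at the times \<open>q\<close> of closest returns the
  arcs between \<open>x\<^sub>i\<close> and \<open>x\<^sub>i\<^sub>-\<^sub>q\<close>, \<open>0 \<le> i < q\<close>, are disjoint. Since the logarithm of the slope has bounded
  variation, the slope of the \<open>q\<close>-th iterate at 0 and the inverse of the slope of the \<open>-q\<close>-th
  iterate at 0 differ by a bounded factor only, which is a contradiction.
\<close>

section \<open>The circle and the dyadic rationals\<close>

lemma to_circle_eq_iff: "to_circle x = to_circle y \<longleftrightarrow> (\<exists>n::int. x = y + of_int n)"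
proof -
  have "to_circle x = to_circle y \<longleftrightarrow> x - y \<in> \<int>"
    by (simp add: circle.abs_eq_iff)
  also have "\<dots> \<longleftrightarrow> (\<exists>n::int. x = y + of_int n)"
    by (auto simp: Ints_def algebra_simps)
  finally show ?thesis .
qed

lemma to_circle_add_int [simp]: "to_circle (x + of_int n) = to_circle x"
  by (auto simp: to_circle_eq_iff)

lemma to_circle_cases: obtains x where "p = to_circle x"
  by (metis Quotient_abs_rep Quotient_circle)

lemma to_circle_inj_near:
  assumes "to_circle x = to_circle y" "\<bar>x - y\<bar> < 1"
  shows "x = y"
  using assms by (auto simp: to_circle_eq_iff)

text \<open>The preimage of a finite subset of the circle is discrete, so breakpoints do not accumulate
  on the line.\<close>

lemma discrete_right_left:
  fixes x :: real
  assumes "finite S"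
  shows "\<exists>e>0. to_circle ` {x<..<x + e} \<inter> S = {} \<and> to_circle ` {x - e<..<x} \<inter> S = {}"
  using assms
proof (induction S rule: finite_induct)
  case empty
  show ?case by (auto intro: exI[of _ 1])
next
  case (insert s S)
  then obtain e where e: "e > 0" "to_circle ` {x<..<x + e} \<inter> S = {}" "to_circle ` {x - e<..<x} \<inter> S = {}"
    by auto
  obtain y where y: "s = to_circle y" by (rule to_circle_cases)
  define d where "d = (if frac (y - x) = 0 then 1 else min (frac (y - x)) (1 - frac (y - x)))"
  have d: "d > 0" "d \<le> 1"
    using frac_lt_1[of "y - x"] frac_ge_0[of "y - x"] by (auto simp: d_def)
  have avoid: "to_circle z \<noteq> s" if z: "z \<noteq> x" "\<bar>z - x\<bar> < d" for z
  proof
    assume "to_circle z = s"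
    then obtain n :: int where n: "z = y + of_int n" by (auto simp: y to_circle_eq_iff)
    have eq: "y - x = (z - x) + of_int (- n)" using n by simp
    have fr: "frac (y - x) = frac (z - x)"
      unfolding eq frac_unique_iff[of _ "frac (z - x)"]
      using frac_ge_0[of "z - x"] frac_lt_1[of "z - x"] by (simp add: frac_def)
    show False
    proof (cases "z > x")
      case True
      then have "frac (z - x) = z - x" using z d by (simp add: frac_eq)
      then show False using z True fr by (auto simp: d_def split: if_splits)
    next
      case False
      then have "frac (z - x) = frac (z - x + 1)" by (simp only: frac_1_eq)
      also have "\<dots> = z - x + 1" using z d False by (subst frac_eq) auto
      finally show False using z False fr d by (auto simp: d_def split: if_splits)
    qed
  qed
  have far: "to_circle z \<notin> insert s S" if "z \<noteq> x" "\<bar>z - x\<bar> < min d e" for z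
  proof -
    have "z \<in> {x<..<x + e} \<union> {x - e<..<x}" using that by auto
    then have "to_circle z \<notin> S" using e(2,3) by blast
    then show ?thesis using avoid[of z] that by auto
  qed
  have "to_circle ` {x<..<x + min d e} \<inter> insert s S = {}"
    using far by (force simp del: insert_iff simp: disjoint_iff)
  moreover have "to_circle ` {x - min d e<..<x} \<inter> insert s S = {}"
    using far by (force simp del: insert_iff simp: disjoint_iff)
  ultimately show ?case using d e(1) by (intro exI[of _ "min d e"]) auto
qed

lemma dyadic_iff: "x \<in> dyadic \<longleftrightarrow> (\<exists>n::nat. 2 ^ n * x \<in> \<int>)"
proof
  assume "x \<in> dyadic"
  then obtain k :: int and n :: nat where "x = of_int k / 2 ^ n" by (auto simp: dyadic_def)
  then have "2 ^ n * x = of_int k" by simp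
  then show "\<exists>n::nat. 2 ^ n * x \<in> \<int>" by (metis Ints_of_int)
next
  assume "\<exists>n::nat. 2 ^ n * x \<in> \<int>"
  then obtain n :: nat and k where "2 ^ n * x = of_int k" by (auto elim: Ints_cases)
  then have "x = of_int k / 2 ^ n" by (simp add: field_simps)
  then show "x \<in> dyadic" by (auto simp: dyadic_def)
qed

lemma powi_2_inject: "(2::real) powi k = 2 powi l \<longleftrightarrow> k = l"
  by (metis linorder_neqE not_less_iff_gr_or_eq one_less_numeral_iff power_int_strict_increasing
      semiring_norm(76))

lemma pow2_mult_Ints_mono:
  fixes x :: real
  assumes "2 ^ n * x \<in> \<int>" "n \<le> m"
  shows "2 ^ m * x \<in> \<int>"
proof -
  have "2 ^ m * x = of_int (2 ^ (m - n)) * (2 ^ n * x)"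
    using assms(2) by (simp flip: power_add)
  then show ?thesis using assms(1) by (metis Ints_mult Ints_of_int)
qed

lemma dyadic_of_int [simp]: "of_int n \<in> dyadic"
  by (auto simp: dyadic_iff intro: exI[of _ 0])

lemma dyadic_add: "x \<in> dyadic \<Longrightarrow> y \<in> dyadic \<Longrightarrow> x + y \<in> dyadic"
  unfolding dyadic_iff
proof clarify
  fix n m :: nat
  assume "2 ^ n * x \<in> \<int>" "2 ^ m * y \<in> \<int>"
  then have "2 ^ max n m * x \<in> \<int>" "2 ^ max n m * y \<in> \<int>"
    by (auto intro: pow2_mult_Ints_mono)
  then show "\<exists>n. 2 ^ n * (x + y) \<in> \<int>"
    by (auto intro!: exI[of _ "max n m"] simp: distrib_left)
qed

lemma dyadic_uminus: "x \<in> dyadic \<Longrightarrow> - x \<in> dyadic"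
  by (auto simp: dyadic_iff)

lemma dyadic_powi_mult: "x \<in> dyadic \<Longrightarrow> 2 powi k * x \<in> dyadic"
  unfolding dyadic_iff
proof clarify
  fix n :: nat
  assume n: "2 ^ n * x \<in> \<int>"
  have "2 ^ (n + nat (- k)) * (2 powi k * x) = 2 ^ nat k * (2 ^ n * x)"
    by (cases "k \<ge> 0") (simp_all add: power_int_def power_add field_simps)
  also have "\<dots> \<in> \<int>" by (rule Ints_mult[OF _ n]) simp
  finally show "\<exists>n. 2 ^ n * (2 powi k * x) \<in> \<int>" by blast
qed

lemma dyadic_affine_iff:
  assumes "c \<in> dyadic"
  shows "2 powi k * x + c \<in> dyadic \<longleftrightarrow> x \<in> dyadic"
proof
  assume "2 powi k * x + c \<in> dyadic"
  then have "2 powi (- k) * (2 powi k * x + c + - c) \<in> dyadic"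
    by (intro dyadic_powi_mult dyadic_add[OF _ dyadic_uminus[OF assms]])
  moreover have "2 powi (- k) * (2 powi k * x + c + - c) = x"
    by (simp add: power_int_minus flip: mult.assoc)
  ultimately show "x \<in> dyadic" by (simp only:)
qed (intro dyadic_add dyadic_powi_mult assms)

lemma dyadic_dense:
  fixes a b :: real
  assumes "a < b"
  obtains x :: real where "x \<in> dyadic" "a < x" "x < b"
proof -
  obtain n where n: "(1 / 2 :: real) ^ n < b - a"
    using real_arch_pow_inv[of "b - a" "1/2"] assms by auto
  define x :: real where "x = (of_int \<lfloor>a * 2 ^ n\<rfloor> + 1) / 2 ^ n"
  have "x = of_int (\<lfloor>a * 2 ^ n\<rfloor> + 1) / 2 ^ n" by (simp add: x_def)
  then have "x \<in> dyadic" unfolding dyadic_def by blast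
  moreover have "a < x"
    unfolding x_def using floor_correct[of "a * 2 ^ n"] by (simp add: less_divide_eq)
  moreover have "x \<le> a + 1 / 2 ^ n"
    unfolding x_def by (simp add: field_simps)
  then have "x < b" using n by (simp add: power_divide)
  ultimately show ?thesis by (rule that)
qed

text \<open>The 2-adic size of a dyadic rational: the exponent of its reduced denominator.\<close>

definition level :: "real \<Rightarrow> nat" where
  "level x = (LEAST n. 2 ^ n * x \<in> \<int>)"

lemma level_le: "2 ^ n * x \<in> \<int> \<Longrightarrow> level x \<le> n"
  unfolding level_def by (rule Least_le)

lemma pow2_level:
  assumes "x \<in> dyadic" "level x \<le> n"
  shows "2 ^ n * x \<in> \<int>"
proof -
  have "2 ^ level x * x \<in> \<int>"
    using assms(1) unfolding dyadic_iff level_def by (rule LeastI_ex)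
  then show ?thesis using assms(2) by (rule pow2_mult_Ints_mono)
qed

lemma pow2_affine_Ints_iff:
  fixes x c :: real
  assumes "2 ^ n * c \<in> \<int>" "int m = int n + k"
  shows "2 ^ n * (2 powi k * x + c) \<in> \<int> \<longleftrightarrow> 2 ^ m * x \<in> \<int>"
proof -
  have "(2::real) ^ n * 2 powi k = 2 powi (int n + k)"
    by (simp add: power_int_add)
  then have "2 ^ n * (2 powi k * x + c) = 2 ^ m * x + 2 ^ n * c"
    using assms(2) by (simp add: distrib_left flip: mult.assoc) (metis assms(2) power_int_of_nat)
  moreover have "u + v \<in> \<int> \<longleftrightarrow> u \<in> \<int>" if "v \<in> \<int>" for u v :: real
    using that by (metis Ints_add Ints_diff add_diff_cancel_right')
  ultimately show ?thesis using assms(1) by metis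
qed

text \<open>If the denominator of \<open>x\<close> is large compared to the one of \<open>c\<close>, adding \<open>c\<close> does not
  cancel anything, and the multiplication by a power of 2 just shifts the level.\<close>

lemma level_affine:
  assumes x: "x \<in> dyadic" and c: "c \<in> dyadic" and large: "int (level x) > int (level c) + \<bar>k\<bar>"
  shows "int (level (2 powi k * x + c)) = int (level x) - k"
proof -
  define n where "n = nat (int (level x) - k)"
  have n: "int n = int (level x) - k" and n_gt: "n > level c"
    using large by (auto simp: n_def)
  have "level (2 powi k * x + c) \<le> n"
    using pow2_affine_Ints_iff[of n c "level x" k x] n pow2_level[OF c less_imp_le[OF n_gt]]
      pow2_level[OF x order_refl]
    by (intro level_le) simp
  moreover have "\<not> level (2 powi k * x + c) \<le> n - 1"
  proof
    assume *: "level (2 powi k * x + c) \<le> n - 1"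
    have "2 powi k * x + c \<in> dyadic" using x c by (simp add: dyadic_affine_iff)
    then have "2 ^ (n - 1) * (2 powi k * x + c) \<in> \<int>" using * by (rule pow2_level)
    moreover have "2 ^ (n - 1) * c \<in> \<int>" using c n_gt by (intro pow2_level) auto
    moreover have "int (level x - 1) = int (n - 1) + k" using n n_gt large by linarith
    ultimately have "2 ^ (level x - 1) * x \<in> \<int>" by (simp add: pow2_affine_Ints_iff)
    then have "level x \<le> level x - 1" by (rule level_le)
    then show False using large by linarith
  qed
  ultimately show ?thesis using n n_gt by linarith
qed

lemma finite_low_level: "finite (to_circle ` {x \<in> dyadic. level x \<le> C})"
proof (rule finite_subset)
  show "to_circle ` {x \<in> dyadic. level x \<le> C} \<subseteq> (\<lambda>j::int. to_circle (of_int j / 2 ^ C)) ` {0..<2 ^ C}"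
  proof clarify
    fix x assume x: "x \<in> dyadic" "level x \<le> C"
    then have "2 ^ C * x \<in> \<int>" by (rule pow2_level)
    then obtain j where j: "2 ^ C * x = of_int j" by (rule Ints_cases)
    have "x = of_int j / 2 ^ C" using j by (simp add: field_simps)
    also have "real_of_int j = of_int (j mod 2 ^ C + 2 ^ C * (j div 2 ^ C))"
      by simp
    also have "\<dots> = of_int (j mod 2 ^ C) + 2 ^ C * of_int (j div 2 ^ C)"
      by (simp only: of_int_add of_int_mult of_int_power of_int_numeral)
    finally have "x = of_int (j mod 2 ^ C) / 2 ^ C + of_int (j div 2 ^ C)"
      by (simp add: add_divide_distrib)
    then have "to_circle x = to_circle (of_int (j mod 2 ^ C) / 2 ^ C)" by simp
    then show "to_circle x \<in> (\<lambda>j::int. to_circle (of_int j / 2 ^ C)) ` {0..<2 ^ C}" by auto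
  qed
qed simp

section \<open>Monotone bijections of the line\<close>

lemma strict_mono_funpow:
  fixes G :: "real \<Rightarrow> real"
  assumes "strict_mono G"
  shows "strict_mono (G ^^ n)"
proof (induction n)
  case (Suc n)
  then show ?case using strict_mono_o[OF assms Suc] by (simp add: comp_def)
qed (simp add: strict_mono_def)

text \<open>The infimum \<open>L\<close> of the orbit is fixed: if \<open>G L\<close> were smaller than \<open>L\<close>, the preimage of \<open>L\<close> would
  lie above \<open>L\<close>, hence above some point of the orbit, whose image would lie below \<open>L\<close>.\<close>

lemma decreasing_orbit_inf:
  fixes G :: "real \<Rightarrow> real"
  assumes mono: "strict_mono G" and surj: "surj G" and less: "G x < x"
    and bound: "\<And>k. b \<le> (G ^^ k) x"
  obtains L where "b \<le> L" "L < x" "G L = L" "\<And>u. L < u \<Longrightarrow> \<exists>k. (G ^^ k) x < u"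
proof -
  define Orb where "Orb = range (\<lambda>k. (G ^^ k) x)"
  define L where "L = Inf Orb"
  have bdd: "bdd_below Orb" unfolding Orb_def by (intro bdd_belowI[of _ b]) (use bound in auto)
  have le: "L \<le> (G ^^ k) x" for k
    unfolding L_def by (rule cInf_lower[OF _ bdd]) (auto simp: Orb_def)
  have near: "\<exists>k. (G ^^ k) x < u" if "L < u" for u
    using cInf_lessD[of Orb u] that by (auto simp: L_def Orb_def)
  have "b \<le> L" unfolding L_def by (rule cInf_greatest) (use bound in \<open>auto simp: Orb_def\<close>)
  moreover have "L < x" using le[of 1] less by simp
  moreover have "G L = L"
  proof (rule antisym)
    have "G L \<le> y" if "y \<in> Orb" for y
    proof -
      obtain k where k: "y = (G ^^ k) x" using \<open>y \<in> Orb\<close> unfolding Orb_def by blast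
      have "(G ^^ Suc k) x < (G ^^ k) x"
        using strict_monoD[OF strict_mono_funpow[OF mono, of k] less] by (simp add: funpow_swap1)
      moreover have "G L \<le> (G ^^ Suc k) x" using mono le[of k] by (simp add: strict_mono_less_eq)
      ultimately show ?thesis using k by simp
    qed
    then show "G L \<le> L" unfolding L_def by (intro cInf_greatest) (auto simp: Orb_def L_def)
    show "L \<le> G L"
    proof (rule ccontr)
      assume "\<not> L \<le> G L"
      obtain w where w: "L = G w" using surj by (metis surjD)
      then have "L < w" using \<open>\<not> L \<le> G L\<close> mono by (metis strict_mono_less not_le)
      then obtain k where "(G ^^ k) x < w" using near by blast
      then have "(G ^^ Suc k) x < L" using w mono by (simp add: strict_mono_less)
      then show False using le[of "Suc k"] by simp
    qed
  qed
  ultimately show ?thesis using near that by blast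
qed

section \<open>Lifts of elements of Thompson's group\<close>

text \<open>The dynamics is studied on one lift to the line. Its integer translates are further lifts of the
  same map (\<open>translate\<close>), which allows the choice of a lift with a fixed point if the map has one.\<close>

locale thompson_lift =
  fixes f :: "circle \<Rightarrow> circle" and F :: "real \<Rightarrow> real" and S :: "circle set"
  assumes lift: "f (to_circle x) = to_circle (F x)"
    and cont: "continuous_on UNIV F"
    and mono: "strict_mono F"
    and degree_one: "F (x + 1) = F x + 1"
    and finite_breaks: "finite S"
    and affine: "to_circle ` {a<..<b} \<inter> S = {} \<Longrightarrow>
                   \<exists>k::int. \<exists>c. \<forall>x\<in>{a<..<b}. F x = 2 powi k * x + c"
    and dyadic_image: "x \<in> dyadic \<Longrightarrow> F x \<in> dyadic"
begin

lemma lift_add_int: "F (x + of_int n) = F x + of_int n"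
proof (induction n rule: int_induct[where k = 0])
  case (step1 i)
  then show ?case using degree_one[of "x + of_int i"] by (simp add: add.assoc)
next
  case (step2 i)
  then show ?case using degree_one[of "x + of_int (i - 1)"] by simp
qed simp

lemma surj_lift: "surj F"
proof (rule surjI[of _ "\<lambda>y. SOME x. F x = y"])
  fix y :: real
  define n where "n = \<lfloor>y - F 0\<rfloor>"
  have "F (of_int n) = F 0 + of_int n" "F (of_int (n + 1)) = F 0 + of_int n + 1"
    using lift_add_int[of 0 n] lift_add_int[of 0 "n + 1"] by simp_all
  then have "F (of_int n) \<le> y" "y \<le> F (of_int (n + 1))"
    unfolding n_def by linarith+
  then have "\<exists>x. of_int n \<le> x \<and> x \<le> of_int (n + 1) \<and> F x = y"
    using cont by (intro IVT') (auto intro: continuous_on_subset)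
  then show "F (SOME x. F x = y) = y" by (auto intro: someI2)
qed

lemma inj_lift: "inj F"
  using mono by (rule strict_mono_imp_inj_on)

lemma lift_pow: "(f ^^ n) (to_circle x) = to_circle ((F ^^ n) x)"
  by (induction n) (simp_all add: lift)

lemma translate: "thompson_lift f (\<lambda>x. F x + of_int n) S"
proof
  fix a b :: real assume "to_circle ` {a<..<b} \<inter> S = {}"
  then obtain k c where "\<forall>x\<in>{a<..<b}. F x = 2 powi k * x + c" using affine by blast
  then show "\<exists>k::int. \<exists>c. \<forall>x\<in>{a<..<b}. F x + of_int n = 2 powi k * x + c"
    by (intro exI[of _ k] exI[of _ "c + of_int n"]) auto
qed (use lift mono finite_breaks dyadic_image degree_one cont in
      \<open>auto simp: strict_mono_def dyadic_add intro!: continuous_intros\<close>)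

text \<open>The right piece contains its endpoint \<open>x0\<close>: right germs are the ones that are used later.\<close>

lemma affine_pieces:
  obtains e k c k' c' where "e > 0"
    "\<And>x. x0 \<le> x \<Longrightarrow> x < x0 + e \<Longrightarrow> F x = 2 powi k * x + c"
    "\<And>x. x0 - e < x \<Longrightarrow> x < x0 \<Longrightarrow> F x = 2 powi k' * x + c'"
proof -
  obtain e where e: "e > 0" "to_circle ` {x0<..<x0 + e} \<inter> S = {}" "to_circle ` {x0 - e<..<x0} \<inter> S = {}"
    using discrete_right_left[OF finite_breaks] by blast
  obtain k c where kc: "\<forall>x\<in>{x0<..<x0 + e}. F x = 2 powi k * x + c"
    using affine[OF e(2)] by blast
  obtain k' c' where kc': "\<forall>x\<in>{x0 - e<..<x0}. F x = 2 powi k' * x + c'"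
    using affine[OF e(3)] by blast
  have "F x0 = 2 powi k * x0 + c"
  proof (rule tendsto_unique[OF trivial_limit_at_right_real])
    show "(F \<longlongrightarrow> F x0) (at_right x0)"
      using cont by (auto simp: continuous_on_def intro: filterlim_at_withinI tendsto_within_subset)
    have "((\<lambda>x. 2 powi k * x + c) \<longlongrightarrow> 2 powi k * x0 + c) (at_right x0)"
      by (intro tendsto_intros)
    moreover have "\<forall>\<^sub>F x in at_right x0. 2 powi k * x + c = F x"
      unfolding eventually_at_right_field using e(1) kc by (intro exI[of _ "x0 + e"]) auto
    ultimately show "(F \<longlongrightarrow> 2 powi k * x0 + c) (at_right x0)"
      by (rule Lim_transform_eventually)
  qed
  then have "F x = 2 powi k * x + c" if "x0 \<le> x" "x < x0 + e" for x
    using kc that by (cases "x = x0") auto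
  with e(1) kc' show ?thesis by (intro that) auto
qed

text \<open>The binary logarithm of the right derivative.\<close>

definition slope :: "real \<Rightarrow> int" where
  "slope x = (THE k. \<exists>e>0. \<forall>h\<in>{0..<e}. F (x + h) = F x + 2 powi k * h)"

lemma slope_eqI:
  assumes "e > 0" "\<And>h. 0 \<le> h \<Longrightarrow> h < e \<Longrightarrow> F (x + h) = F x + 2 powi k * h"
  shows "slope x = k"
  unfolding slope_def
proof (rule the_equality)
  show "\<exists>e>0. \<forall>h\<in>{0..<e}. F (x + h) = F x + 2 powi k * h" using assms by auto
  fix l assume "\<exists>e>0. \<forall>h\<in>{0..<e}. F (x + h) = F x + 2 powi l * h"
  then obtain d where d: "d > 0" "\<forall>h\<in>{0..<d}. F (x + h) = F x + 2 powi l * h" by auto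
  define h where "h = min e d / 2"
  have "h > 0" "h < e" "h < d" using assms(1) d(1) by (auto simp: h_def)
  then have "2 powi k * h = 2 powi l * h" using assms(2)[of h] d(2) by auto
  then have "(2::real) powi k = 2 powi l" using \<open>h > 0\<close> by simp
  then show "l = k" by (simp add: powi_2_inject)
qed

lemma slope_affine:
  assumes "\<And>z. x \<le> z \<Longrightarrow> z < b \<Longrightarrow> F z = 2 powi k * z + c" "x < b"
  shows "slope x = k"
  using assms by (intro slope_eqI[of "b - x"]) (auto simp: algebra_simps)

lemma right_germ: "\<exists>e>0. \<forall>h\<in>{0..<e}. F (x + h) = F x + 2 powi slope x * h"
proof -
  obtain e k c k' c' where e: "e > 0"
    "\<And>z. x \<le> z \<Longrightarrow> z < x + e \<Longrightarrow> F z = 2 powi k * z + c"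
    using affine_pieces by metis
  then have "slope x = k" by (intro slope_affine[of x "x + e"]) auto
  then show ?thesis using e by (intro exI[of _ e]) (auto simp: algebra_simps)
qed

lemma slope_periodic: "slope (x + of_int n) = slope x"
proof -
  obtain e where e: "e > 0" "\<forall>h\<in>{0..<e}. F (x + h) = F x + 2 powi slope x * h"
    using right_germ by blast
  have "F (x + of_int n + h) = F (x + of_int n) + 2 powi slope x * h" if "0 \<le> h" "h < e" for h
    using e(2) that lift_add_int[of "x + h" n] lift_add_int[of x n] by (simp add: algebra_simps)
  then show ?thesis using e(1) by (rule slope_eqI[rotated])
qed

lemma slope_change_needs_break:
  assumes "x < y" "slope x \<noteq> slope y"
  shows "\<exists>z. x < z \<and> z \<le> y \<and> to_circle z \<in> S"
proof (rule ccontr)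
  assume none: "\<not> ?thesis"
  obtain e where e: "e > 0" "to_circle ` {y<..<y + e} \<inter> S = {}"
    using discrete_right_left[OF finite_breaks] by blast
  have "to_circle z \<notin> S" if "z \<in> {x<..<y + e}" for z
  proof (cases "z \<le> y")
    case False
    then have "z \<in> {y<..<y + e}" using that by simp
    then show ?thesis using e(2) by blast
  qed (use none that in auto)
  then have "to_circle ` {x<..<y + e} \<inter> S = {}" by blast
  then obtain k c where kc: "\<forall>z\<in>{x<..<y + e}. F z = 2 powi k * z + c" using affine by blast
  then have "slope y = k" using e(1) assms(1) by (intro slope_affine[of y "y + e"]) auto
  moreover
  obtain d where d: "d > 0" "\<forall>h\<in>{0..<d}. F (x + h) = F x + 2 powi slope x * h"
    using right_germ by blast
  define h where "h = min d (y - x) / 2"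
  have h: "h > 0" "2 * h \<le> d" "2 * h \<le> y - x" using d(1) assms(1) by (auto simp: h_def)
  have "slope (x + h) = k"
    using kc h e(1) by (intro slope_affine[of _ "y + e"]) auto
  moreover have "slope (x + h) = slope x"
  proof (rule slope_eqI[OF h(1)])
    fix u assume "0 \<le> u" "u < h"
    then show "F (x + h + u) = F (x + h) + 2 powi slope x * u"
      using d(2)[rule_format, of "h + u"] d(2)[rule_format, of h] h by (simp add: algebra_simps)
  qed
  ultimately show False using assms(2) by simp
qed

text \<open>Away from finitely many denominators, an application of the map lowers the level of a dyadic
  point by the binary logarithm of the slope at that point.\<close>

lemma level_shift:
  obtains N where "\<And>x. \<bar>slope x\<bar> \<le> int N"
    "\<And>x. F x \<in> dyadic \<longleftrightarrow> x \<in> dyadic"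
    "\<And>x. x \<in> dyadic \<Longrightarrow> level x > N \<Longrightarrow> int (level (F x)) = int (level x) - slope x"
proof -
  \<comment> \<open>a finite bound exists near each point, on both sides, hence on the compact interval \<open>[0, 1]\<close>,
    and by periodicity everywhere\<close>
  define good where "good N x \<longleftrightarrow> \<bar>slope x\<bar> \<le> int N \<and> (F x \<in> dyadic \<longleftrightarrow> x \<in> dyadic) \<and>
    (x \<in> dyadic \<longrightarrow> level x > N \<longrightarrow> int (level (F x)) = int (level x) - slope x)" for N x
  have good_mono: "good N x \<Longrightarrow> N \<le> M \<Longrightarrow> good M x" for N M x
    unfolding good_def by (auto intro: order_trans)
  have piece: "\<exists>N. \<forall>x<b. (\<forall>z. x \<le> z \<longrightarrow> z < b \<longrightarrow> F z = 2 powi k * z + c) \<longrightarrow> good N x"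
    if aff: "\<And>x. a < x \<Longrightarrow> x < b \<Longrightarrow> F x = 2 powi k * x + c" and "a < b" for a b k c
  proof -
    \<comment> \<open>comparing the values at a dyadic point shows that the constant term is dyadic\<close>
    obtain y where y: "y \<in> dyadic" "a < y" "y < b" using dyadic_dense[OF \<open>a < b\<close>] .
    have "c = F y + - (2 powi k * y)" using aff[of y] y by simp
    then have c: "c \<in> dyadic"
      using y(1) dyadic_image by (simp only:) (intro dyadic_add dyadic_uminus dyadic_powi_mult)
    have "good (level c + nat \<bar>k\<bar>) x"
      if x: "x < b" "\<forall>z. x \<le> z \<longrightarrow> z < b \<longrightarrow> F z = 2 powi k * z + c" for x
    proof -
      have "slope x = k" using x by (intro slope_affine[of x b]) auto
      moreover have "F x = 2 powi k * x + c" using x by simp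
      ultimately show ?thesis
        unfolding good_def using c level_affine[of x c k] by (auto simp: dyadic_affine_iff)
    qed
    then show ?thesis by blast
  qed
  have "\<exists>N. \<forall>x\<in>{0..1}. good N x"
  proof (rule Bolzano[where P = "\<lambda>a b. \<exists>N. \<forall>x\<in>{a..b}. good N x"])
    fix a b c :: real
    assume "\<exists>N. \<forall>x\<in>{a..b}. good N x" "\<exists>N. \<forall>x\<in>{b..c}. good N x" "a \<le> b" "b \<le> c"
    then obtain N M where "\<forall>x\<in>{a..b}. good N x" "\<forall>x\<in>{b..c}. good M x" by blast
    then have "\<forall>x\<in>{a..c}. good (max N M) x"
      by (metis atLeastAtMost_iff good_mono linear max.cobounded1 max.cobounded2)
    then show "\<exists>N. \<forall>x\<in>{a..c}. good N x" by blast
  next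
    fix x0 :: real
    obtain e k c k' c' where e: "e > 0"
      "\<And>x. x0 \<le> x \<Longrightarrow> x < x0 + e \<Longrightarrow> F x = 2 powi k * x + c"
      "\<And>x. x0 - e < x \<Longrightarrow> x < x0 \<Longrightarrow> F x = 2 powi k' * x + c'"
      using affine_pieces by metis
    obtain N where "\<forall>x<x0 + e. (\<forall>z. x \<le> z \<longrightarrow> z < x0 + e \<longrightarrow> F z = 2 powi k * z + c) \<longrightarrow> good N x"
      using piece[of x0 "x0 + e" k c] e by force
    then have N: "good N x" if "x0 \<le> x" "x < x0 + e" for x
      using that e(2) by simp
    obtain M where "\<forall>x<x0. (\<forall>z. x \<le> z \<longrightarrow> z < x0 \<longrightarrow> F z = 2 powi k' * z + c') \<longrightarrow> good M x"
      using piece[of "x0 - e" x0 k' c'] e by force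
    then have M: "good M x" if "x0 - e < x" "x < x0" for x
      using that e(3) by simp
    have "good (max N M) x" if "x0 - e < x" "x < x0 + e" for x
      using N[of x] M[of x] that good_mono[of N x "max N M"] good_mono[of M x "max N M"]
      by (cases "x < x0") auto
    then have "\<forall>a b. a \<le> x0 \<and> x0 \<le> b \<and> b - a < e \<longrightarrow> (\<exists>N. \<forall>x\<in>{a..b}. good N x)"
      by (auto intro!: exI[of _ "max N M"])
    then show "\<exists>d>0. \<forall>a b. a \<le> x0 \<and> x0 \<le> b \<and> b - a < d \<longrightarrow> (\<exists>N. \<forall>x\<in>{a..b}. good N x)"
      using e(1) by blast
  qed simp
  then obtain N where "\<forall>x\<in>{0..1}. good N x" ..
  then have N: "good N x" if "0 \<le> x" "x \<le> 1" for x using that by simp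
  have dyadic_periodic: "x + of_int n \<in> dyadic \<longleftrightarrow> x \<in> dyadic" for x n
    using dyadic_affine_iff[of "of_int n" 0 x] by simp
  have level_periodic: "level (x + of_int n) = level x" for x n
  proof -
    have "2 ^ m * (x + of_int n) \<in> \<int> \<longleftrightarrow> 2 ^ m * x \<in> \<int>" for m :: nat
      using pow2_affine_Ints_iff[of m "of_int n" m 0 x] by simp
    then show ?thesis unfolding level_def by simp
  qed
  have "good N x" for x
  proof -
    have "good N (frac x)" by (intro N) (auto intro: less_imp_le frac_lt_1)
    moreover have "x = frac x + of_int \<lfloor>x\<rfloor>" by (simp add: frac_def)
    ultimately show ?thesis
      unfolding good_def by (metis dyadic_periodic level_periodic slope_periodic lift_add_int)
  qed
  then show ?thesis unfolding good_def by (intro that[of N]) auto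
qed

end

section \<open>Periodic points\<close>

context thompson_lift
begin

definition iter :: "int \<Rightarrow> real \<Rightarrow> real" where
  "iter i = (if i \<ge> 0 then F ^^ nat i else inv_into UNIV F ^^ nat (- i))"

lemma iter_0 [simp]: "iter 0 x = x"
  by (simp add: iter_def)

lemma iter_of_nat: "iter (int n) = F ^^ n"
  by (simp add: iter_def)

lemma iter_Suc: "iter (i + 1) x = F (iter i x)"
proof (cases "i \<ge> 0")
  case True
  then have "nat (i + 1) = Suc (nat i)" by simp
  with True show ?thesis by (simp add: iter_def)
next
  case False
  then have "nat (- i) = Suc (nat (- (i + 1)))" by simp
  then have "F ((inv_into UNIV F ^^ nat (- i)) x) = (inv_into UNIV F ^^ nat (- (i + 1))) x"
    by (simp add: surj_f_inv_f[OF surj_lift])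
  with False show ?thesis by (auto simp: iter_def)
qed

lemma iter_pred: "F (iter (i - 1) x) = iter i x"
  using iter_Suc[of "i - 1" x] by simp

lemma iter_add: "iter (i + j) x = iter i (iter j x)"
proof (induction i rule: int_induct[where k = 0])
  case (step1 i)
  then show ?case using iter_Suc[of "i + j" x] iter_Suc[of i "iter j x"] by (simp add: algebra_simps)
next
  case (step2 i)
  have "F (iter (i - 1 + j) x) = F (iter (i - 1) (iter j x))"
    using step2 iter_pred[of "i + j" x] iter_pred[of i "iter j x"] by (simp add: algebra_simps)
  then show ?case using inj_lift by (simp add: inj_eq)
qed simp

lemma iter_add_int: "iter i (x + of_int n) = iter i x + of_int n"
proof (induction i rule: int_induct[where k = 0])
  case (step1 i)
  then show ?case by (simp add: iter_Suc lift_add_int)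
next
  case (step2 i)
  then have "F (iter (i - 1) (x + of_int n)) = F (iter (i - 1) x + of_int n)"
    by (simp add: iter_pred lift_add_int)
  then show ?case using inj_lift by (simp add: inj_eq)
qed simp

lemma strict_mono_iter: "strict_mono (iter i)"
proof (induction i rule: int_induct[where k = 0])
  case base
  show ?case by (simp add: strict_mono_def)
next
  case (step1 i)
  then show ?case using mono by (simp add: strict_mono_def iter_Suc)
next
  case (step2 i)
  have "iter (i - 1) x < iter (i - 1) y" if "x < y" for x y
    using strict_monoD[OF step2(2) that] mono by (metis iter_pred strict_mono_less)
  then show ?case by (rule strict_monoI)
qed

lemma iter_cancel [simp]: "iter i (iter (- i) x) = x" "iter (- i) (iter i x) = x"
  using iter_add[of i "- i" x] iter_add[of "- i" i x] by simp_all

lemma to_circle_iter: "to_circle (iter (int n) x) = (f ^^ n) (to_circle x)"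
  by (simp add: iter_of_nat lift_pow)

end

text \<open>The hypothesis excludes periodic points on the circle. It makes the translated orbit points
  \<open>orb i p\<close> pairwise distinct, and their order on the line is invariant under shifts of the indices.\<close>

locale aperiodic_lift = thompson_lift +
  assumes aperiodic: "i \<noteq> 0 \<Longrightarrow> iter i x \<noteq> x + of_int n"
begin

definition orb :: "int \<Rightarrow> int \<Rightarrow> real" where
  "orb i p = iter i 0 + of_int p"

lemma orb_inject: "orb i p = orb j r \<longleftrightarrow> i = j \<and> p = r"
proof
  assume eq: "orb i p = orb j r"
  have "iter (i - j) (iter j 0) = iter j 0 + of_int (r - p)"
    using eq iter_add[of "i - j" j 0] by (simp add: orb_def)
  then have "i = j" using aperiodic[of "i - j" "iter j 0" "r - p"] by auto
  then show "i = j \<and> p = r" using eq by (simp add: orb_def)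
qed simp

lemma orb_0 [simp]: "orb 0 p = of_int p"
  by (simp add: orb_def)

lemma orb_shift: "orb (l + i) (p + s) = iter l (orb i p) + of_int s"
  by (simp add: orb_def iter_add iter_add_int)

lemma orb_less_shift: "orb (l + i) (p + s) < orb (l + j) (r + s) \<longleftrightarrow> orb i p < orb j r"
  by (simp add: orb_shift strict_mono_less[OF strict_mono_iter])

text \<open>The orbit of 0 on the circle has infinitely many closest returns from the left: otherwise
  there is a gap to the left of 0 whose translates under some power of the map form a monotone
  chain, and the chain converges to a periodic point.\<close>

lemma closest_returns:
  obtains m p where "\<bar>m\<bar> > int Q" "orb m p < 0"
    "\<And>l r. \<bar>l\<bar> < \<bar>m\<bar> \<Longrightarrow> orb m p < orb l r \<Longrightarrow> 0 \<le> orb l r"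
proof (rule ccontr)
  assume none: "\<not> thesis"
  \<comment> \<open>the representative in \<open>[-1, 0)\<close> of the point of time \<open>l\<close>\<close>
  define y where "y l = orb l (- \<lfloor>iter l 0\<rfloor> - 1)" for l
  have y_range: "- 1 \<le> y l" "y l < 0" for l
    unfolding y_def orb_def using of_int_floor_le[of "iter l 0"] floor_correct[of "iter l 0"]
    by (simp_all, linarith+)
  have y_unique: "orb l r = y l" if "- 1 \<le> orb l r" "orb l r < 0" for l r
  proof -
    have "\<lfloor>iter l 0\<rfloor> = - r - 1"
      using that by (intro floor_unique) (auto simp: orb_def)
    then show ?thesis by (simp add: y_def)
  qed
  have best: "\<exists>m. \<bar>m\<bar> \<le> int n \<and> \<bar>m\<bar> \<le> int Q \<and> (\<forall>l. \<bar>l\<bar> \<le> int n \<longrightarrow> y l \<le> y m)" for n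
  proof -
    have "Max (y ` {- int n..int n}) \<in> y ` {- int n..int n}" by (rule Max_in) auto
    then obtain m where m: "m \<in> {- int n..int n}" "y m = Max (y ` {- int n..int n})"
      by (metis imageE)
    have max: "y l \<le> y m" if "\<bar>l\<bar> \<le> int n" for l
      unfolding m(2) using that by (intro Max_ge imageI) auto
    have "\<bar>m\<bar> \<le> int Q"
    proof (rule ccontr)
      assume "\<not> \<bar>m\<bar> \<le> int Q"
      moreover have False if "\<bar>l\<bar> < \<bar>m\<bar>" "y m < orb l r" "orb l r < 0" for l r
      proof -
        have "\<bar>l\<bar> \<le> int n" using that(1) m(1) unfolding atLeastAtMost_iff by linarith
        then show False using y_unique[of l r] y_range(1)[of m] that max[of l] by simp
      qed
      ultimately show False using none that y_range(2)[of m] unfolding y_def by force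
    qed
    then show ?thesis using m(1) max by (intro exI[of _ m]) auto
  qed
  \<comment> \<open>if closest returns only occur up to time \<open>Q\<close>, one of them remains closest forever\<close>
  obtain m where m: "\<bar>m\<bar> \<le> int Q" "\<And>l. \<bar>l\<bar> \<le> int Q \<Longrightarrow> y l \<le> y m"
    using best[of Q] by auto
  have y_max: "y l \<le> y m" for l
  proof -
    obtain m' where "\<bar>m'\<bar> \<le> int Q" "y l \<le> y m'"
      using best[of "max Q (nat \<bar>l\<bar>)"] by (auto simp: max_def split: if_splits)
    then show ?thesis using m(2) by (meson order_trans)
  qed
  define p where "p = - \<lfloor>iter m 0\<rfloor> - 1"
  have y_m: "y m = orb m p" by (simp add: y_def p_def)
  have gap: False if "orb m p < orb l r" "orb l r < 0" for l r
    using that y_unique[of l r] y_range(1)[of m] y_max[of l] by (simp add: y_m)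
  have "m \<noteq> 0"
  proof
    assume "m = 0"
    then have "y m = - 1" by (simp add: y_def)
    then have "orb 1 (- \<lfloor>iter 1 0\<rfloor> - 1) = orb 0 (- 1)"
      using y_max[of 1] y_range(1)[of 1] by (simp add: y_def)
    then show False unfolding orb_inject by simp
  qed
  define G where "G x = iter m x + of_int p" for x
  have mono_G: "strict_mono G"
    using strict_mono_iter[of m] by (simp add: G_def strict_mono_def)
  have surj_G: "surj G"
    by (rule surjI[of _ "\<lambda>x. iter (- m) (x - of_int p)"]) (simp add: G_def)
  have G_pow: "(G ^^ k) 0 = orb (int k * m) (int k * p)" for k
  proof (induction k)
    case (Suc k)
    then show ?case
      using orb_shift[of m "int k * m" "int k * p" p] by (simp add: G_def algebra_simps)
  qed simp
  \<comment> \<open>the chain cannot jump over \<open>-1\<close>, which is an orbit point and would lie in a translated gap\<close>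
  have above: "- 1 < orb (int k * m) (int k * p)" for k
  proof (induction k)
    case (Suc k)
    show ?case
    proof (rule ccontr)
      assume "\<not> ?case"
      moreover have "orb (int (Suc k) * m) (int (Suc k) * p) \<noteq> orb 0 (- 1)"
        unfolding orb_inject using \<open>m \<noteq> 0\<close> by simp
      ultimately have "orb (int (Suc k) * m) (int (Suc k) * p) < orb 0 (- 1)" by simp
      then have "orb m p < orb (- (int k * m)) (- 1 - int k * p)"
        using orb_less_shift[of "- (int k * m)" "int (Suc k) * m" "int (Suc k) * p" "- (int k * p)"
            0 "- 1"] by (simp add: algebra_simps)
      moreover have "orb (- (int k * m)) (- 1 - int k * p) < orb 0 0"
        using orb_less_shift[of "- (int k * m)" 0 "- 1" "- (int k * p)" "int k * m" "int k * p"] Suc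
        by (simp add: algebra_simps)
      ultimately show False using gap by simp
    qed
  qed simp
  have "G 0 < 0" using y_range(2)[of m] by (simp add: G_def y_m orb_def)
  moreover have "- 1 \<le> (G ^^ k) 0" for k using above[of k] by (simp add: G_pow)
  ultimately obtain L where "G L = L"
    using decreasing_orbit_inf[OF mono_G surj_G, of 0 "- 1"] by blast
  then have "iter m L = L + of_int (- p)" by (simp add: G_def)
  then show False using aperiodic[OF \<open>m \<noteq> 0\<close>] by blast
qed

text \<open>Denjoy's inequality. At a closest return, the arcs between the points of the orbit and their
  returns are disjoint: if two of them meet, an endpoint of one lies in the other, and a shift of
  indices moves this endpoint into the gap next to 0. Hence the slope can change within at most
  \<open>card S\<close> of the arcs.\<close>

lemma slope_sums_close:
  assumes N: "\<And>x. \<bar>slope x\<bar> \<le> int N"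
    and neg: "orb m p < 0"
    and gap: "\<And>l r. \<bar>l\<bar> < \<bar>m\<bar> \<Longrightarrow> orb m p < orb l r \<Longrightarrow> 0 \<le> orb l r"
  shows "\<bar>(\<Sum>i\<in>{- \<bar>m\<bar>..<0}. slope (iter i 0)) - (\<Sum>i\<in>{0..<\<bar>m\<bar>}. slope (iter i 0))\<bar>
           \<le> 2 * int N * int (card S)"
proof -
  \<comment> \<open>the \<open>m\<close>-translate of this index interval is the other one of \<open>[-q, 0)\<close> and \<open>[0, q)\<close>, \<open>q = \<bar>m\<bar>\<close>\<close>
  define I where "I = (if m < 0 then {0..<- m} else {- m..<0})"
  define D where "D i = slope (iter (m + i) 0) - slope (iter i 0)" for i
  define J where "J = {i \<in> I. D i \<noteq> 0}"
  have fin: "finite I" by (simp add: I_def)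
  have close: "\<bar>i - j\<bar> < \<bar>m\<bar>" if "i \<in> I" "j \<in> I" for i j
    using that by (auto simp: I_def split: if_splits)
  have "\<exists>z. orb (i + m) p < z \<and> z \<le> orb i 0 \<and> to_circle z \<in> S" if "i \<in> J" for i
  proof (rule slope_change_needs_break)
    show "orb (i + m) p < orb i 0"
      using orb_less_shift[of i m p 0 0 0] neg by simp
    show "slope (orb (i + m) p) \<noteq> slope (orb i 0)"
      using that by (simp only: J_def D_def orb_def slope_periodic add.commute[of m]) simp
  qed
  then obtain z where z: "\<And>i. i \<in> J \<Longrightarrow> orb (i + m) p < z i"
      "\<And>i. i \<in> J \<Longrightarrow> z i \<le> orb i 0" "\<And>i. i \<in> J \<Longrightarrow> to_circle (z i) \<in> S"
    by metis
  have "inj_on (\<lambda>i. to_circle (z i)) J"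
  proof (rule inj_onI, rule ccontr)
    fix i j assume ij: "i \<in> J" "j \<in> J" "to_circle (z i) = to_circle (z j)" "i \<noteq> j"
    then obtain r where r: "z i = z j + of_int r" by (auto simp: to_circle_eq_iff)
    have near: "\<bar>j - i\<bar> < \<bar>m\<bar>" "\<bar>i - j\<bar> < \<bar>m\<bar>" using close ij by (auto simp: J_def)
    have zj: "orb (j + m) (p + r) < z i" "z i \<le> orb j r"
      using z(1,2)[OF ij(2)] r by (auto simp: orb_def)
    show False
    proof (cases "orb j r < orb i 0")
      case True
      have "orb m p < orb (j - i) r"
        using orb_less_shift[of "- i" "i + m" p 0 j r] z(1)[OF ij(1)] zj(2) by simp
      moreover have "orb (j - i) r < 0"
        using orb_less_shift[of "- i" j r 0 i 0] True by simp
      ultimately show False using gap near by (meson not_le)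
    next
      case False
      moreover have "orb j r \<noteq> orb i 0" using ij(4) by (simp add: orb_inject)
      ultimately have less: "orb i 0 < orb j r" by simp
      have "orb m p < orb (i - j) (- r)"
        using orb_less_shift[of "- j" "j + m" "p + r" "- r" i 0] zj(1) z(2)[OF ij(1)] by simp
      moreover have "orb (i - j) (- r) < 0"
        using orb_less_shift[of "- j" i 0 "- r" j r] less by simp
      ultimately show False using gap near by (meson not_le)
    qed
  qed
  then have card: "card J \<le> card S"
    using z(3) finite_breaks by (intro card_inj_on_le[of "\<lambda>i. to_circle (z i)"]) auto
  have "\<bar>\<Sum>i\<in>I. D i\<bar> \<le> (\<Sum>i\<in>I. \<bar>D i\<bar>)" by (rule sum_abs)
  also have "\<dots> = (\<Sum>i\<in>J. \<bar>D i\<bar>)"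
    unfolding J_def using fin by (intro sum.mono_neutral_right) auto
  also have "\<dots> \<le> (\<Sum>i\<in>J. 2 * int N)"
  proof (rule sum_mono)
    fix i show "\<bar>D i\<bar> \<le> 2 * int N"
      using N[of "iter (m + i) 0"] N[of "iter i 0"] unfolding D_def by linarith
  qed
  also have "\<dots> \<le> 2 * int N * int (card S)" using card by (simp add: mult.commute mult_left_mono)
  finally have "\<bar>\<Sum>i\<in>I. D i\<bar> \<le> 2 * int N * int (card S)" .
  moreover have "(\<Sum>i\<in>I. D i) = (\<Sum>i\<in>(+) m ` I. slope (iter i 0)) - (\<Sum>i\<in>I. slope (iter i 0))"
    by (simp add: D_def sum_subtractf sum.reindex)
  moreover have "(+) m ` I = (if m < 0 then {m..<0} else {0..<m})"
    by (auto simp: I_def image_add_atLeastLessThan)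
  ultimately show ?thesis
    by (cases "m < 0") (auto simp: I_def abs_minus_commute)
qed

text \<open>Up to an error from the finitely many points of small level, the sum of the slopes telescopes
  to a difference of levels. Denjoy's inequality then bounds the sum of the levels at the times \<open>q\<close> and
  \<open>-q\<close> for infinitely many \<open>q\<close>, although there are only finitely many points of bounded level.\<close>

lemma no_aperiodic_lift: False
proof -
  obtain N where N: "\<And>x. \<bar>slope x\<bar> \<le> int N"
    and dy: "\<And>x. F x \<in> dyadic \<longleftrightarrow> x \<in> dyadic"
    and shift: "\<And>x. x \<in> dyadic \<Longrightarrow> level x > N \<Longrightarrow> int (level (F x)) = int (level x) - slope x"
    using level_shift by blast
  define lev where "lev i = int (level (iter i 0))" for i
  have dyadic: "iter i 0 \<in> dyadic" for i
  proof (induction i rule: int_induct[where k = 0])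
    case base
    show ?case using dyadic_of_int[of 0] by simp
  next
    case (step1 i)
    then show ?case by (simp add: iter_Suc dy)
  next
    case (step2 i)
    then show ?case using dy iter_pred[of i 0] by metis
  qed
  have fin: "finite {i. lev i \<le> int C}" for C
  proof (rule inj_on_finite[OF _ _ finite_low_level])
    show "inj_on (\<lambda>i. to_circle (iter i 0)) {i. lev i \<le> int C}"
    proof (rule inj_onI)
      fix i j assume "to_circle (iter i 0) = to_circle (iter j 0)"
      then obtain n where "orb i 0 = orb j n" by (auto simp: to_circle_eq_iff orb_def)
      then show "i = j" by (simp add: orb_inject)
    qed
    show "(\<lambda>i. to_circle (iter i 0)) ` {i. lev i \<le> int C} \<subseteq> to_circle ` {x \<in> dyadic. level x \<le> C}"
      using dyadic by (auto simp: lev_def)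
  qed
  define e where "e i = slope (iter i 0) - (lev i - lev (i + 1))" for i
  define Z where "Z = {i. e i \<noteq> 0}"
  have "Z \<subseteq> {i. lev i \<le> int N}"
  proof
    fix i assume "i \<in> Z"
    then show "i \<in> {i. lev i \<le> int N}"
      using shift[OF dyadic[of i]] by (force simp: Z_def e_def lev_def iter_Suc)
  qed
  then have fin_Z: "finite Z" using fin by (rule finite_subset)
  define E where "E = (\<Sum>i\<in>Z. \<bar>e i\<bar>)"
  have "E \<ge> 0" unfolding E_def by (rule sum_nonneg) simp
  have telescope: "\<bar>(\<Sum>i\<in>{a..<b}. slope (iter i 0)) - (lev a - lev b)\<bar> \<le> E" if "a \<le> b" for a b
  proof -
    have "(\<Sum>i\<in>{a..<b}. e i) = (\<Sum>i\<in>{a..<b}. slope (iter i 0)) - (lev a - lev b)"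
      using that
    proof (induction b rule: int_ge_induct)
      case (step b)
      have "{a..<b + 1} = insert b {a..<b}" using step(1) by auto
      then show ?case using step by (simp add: e_def)
    qed simp
    moreover have "\<bar>\<Sum>i\<in>{a..<b}. e i\<bar> \<le> (\<Sum>i\<in>{a..<b}. \<bar>e i\<bar>)" by (rule sum_abs)
    moreover have "(\<Sum>i\<in>{a..<b}. \<bar>e i\<bar>) = (\<Sum>i\<in>{a..<b} \<inter> Z. \<bar>e i\<bar>)"
      by (rule sum.mono_neutral_right) (auto simp: Z_def)
    moreover have "\<dots> \<le> E" unfolding E_def using fin_Z by (intro sum_mono2) auto
    ultimately show ?thesis by linarith
  qed
  define C where "C = nat (2 * lev 0 + 2 * E + 2 * int N * int (card S))"
  have C: "int C = 2 * lev 0 + 2 * E + 2 * int N * int (card S)"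
    unfolding C_def using \<open>E \<ge> 0\<close> by (simp add: lev_def)
  obtain Q where Q: "\<And>i. lev i \<le> int C \<Longrightarrow> \<bar>i\<bar> \<le> int Q"
  proof
    fix i assume "lev i \<le> int C"
    then have "\<bar>i\<bar> \<le> Max (abs ` {i. lev i \<le> int C})" using fin by (intro Max_ge) auto
    then show "\<bar>i\<bar> \<le> int (nat (Max (abs ` {i. lev i \<le> int C})))" by linarith
  qed
  obtain m p where m: "\<bar>m\<bar> > int Q" "orb m p < 0"
    "\<And>l r. \<bar>l\<bar> < \<bar>m\<bar> \<Longrightarrow> orb m p < orb l r \<Longrightarrow> 0 \<le> orb l r"
    using closest_returns[of Q] by blast
  have "lev \<bar>m\<bar> + lev (- \<bar>m\<bar>) \<le> int C"
    using slope_sums_close[OF N m(2) m(3)] telescope[of "- \<bar>m\<bar>" 0] telescope[of 0 "\<bar>m\<bar>"]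
    unfolding C by linarith
  then have "lev \<bar>m\<bar> \<le> int C" by (simp add: lev_def)
  then show False using Q[of "\<bar>m\<bar>"] m(1) by simp
qed

end

lemma (in thompson_lift) has_periodic_point: "\<exists>n x. n > 0 \<and> (f ^^ n) x = x"
proof (rule ccontr)
  assume none: "\<not> ?thesis"
  have aperiodic: "iter i x \<noteq> x + of_int n" if "i \<noteq> 0" for i x n
  proof
    assume eq: "iter i x = x + of_int n"
    show False
    proof (cases "i > 0")
      case True
      then have "(f ^^ nat i) (to_circle x) = to_circle x"
        using to_circle_iter[of "nat i" x] eq by simp
      then show False using none True by (metis zero_less_nat_eq)
    next
      case False
      have "iter (- i) x = x + of_int (- n)"
        using iter_add_int[of "- i" x n] eq by (metis add_diff_cancel_right' iter_cancel(2) of_int_minus diff_conv_add_uminus)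
      then have "(f ^^ nat (- i)) (to_circle x) = to_circle x"
        using to_circle_iter[of "nat (- i)" x] to_circle_add_int[of x "- n"] False by simp
      then show False using none False that by (metis linorder_neqE_linordered_idom neg_0_less_iff_less zero_less_nat_eq)
    qed
  qed
  interpret aperiodic_lift f F S by unfold_locales (rule aperiodic)
  show False by (rule no_aperiodic_lift)
qed

section \<open>Elements of Thompson's group and their right germs\<close>

lemma thompson_has_lift:
  assumes f: "f \<in> carrier thompson_T"
  obtains F S where "thompson_lift f F S"
proof -
  obtain g where g: "homeomorphism UNIV UNIV f g"
    and dy: "f ` to_circle ` dyadic \<subseteq> to_circle ` dyadic"
    using f by (auto simp: thompson_T_def)
  obtain F where "is_lift F f" and mono: "strict_mono F" and pl: "piecewise_linear F"
    and deriv: "\<And>x d. (F has_real_derivative d) (at x) \<Longrightarrow> \<exists>k::int. d = 2 powi k"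
    using f by (auto simp: thompson_T_def)
  then have cont: "continuous_on UNIV F" and lift: "\<And>x. f (to_circle x) = to_circle (F x)"
    by (auto simp: is_lift_def)
  have inj: "inj f" using g by (metis UNIV_I homeomorphism_apply1 injI)
  obtain S where S: "finite S"
    "\<And>a b. to_circle ` {a<..<b} \<inter> S = {} \<Longrightarrow> \<exists>m c. \<forall>x\<in>{a<..<b}. F x = m * x + c"
    using pl unfolding piecewise_linear_def by blast
  have "thompson_lift f F S"
  proof
    fix x
    have "to_circle (F (x + 1)) = to_circle (F x)"
      using lift[of "x + 1"] lift[of x] to_circle_add_int[of x 1] by simp
    then obtain n where n: "F (x + 1) = F x + of_int n" by (auto simp: to_circle_eq_iff)
    have "F x < F (x + 1)" using mono by (simp add: strict_mono_def)
    then have "n \<ge> 1" using n by simp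
    moreover have "\<not> n > 1"
      \<comment> \<open>otherwise the lift passes through \<open>F x + 1\<close> too early, and the circle map is not injective\<close>
    proof
      assume "n > 1"
      then have "F x \<le> F x + 1" "F x + 1 \<le> F (x + 1)" using n by simp_all
      then obtain y where y: "x \<le> y" "y \<le> x + 1" "F y = F x + 1"
        using IVT'[of F x "F x + 1" "x + 1"] cont by (auto intro: continuous_on_subset)
      have "y \<noteq> x" "y \<noteq> x + 1" using y(3) n \<open>n > 1\<close> by auto
      moreover have "f (to_circle y) = f (to_circle x)"
        using lift y(3) to_circle_add_int[of "F x" 1] by simp
      then have "to_circle y = to_circle x" using inj by (simp add: inj_eq)
      ultimately show False using to_circle_inj_near[of y x] y(1,2) by auto
    qed
    ultimately show "F (x + 1) = F x + 1" using n by simp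
  next
    fix a b :: real assume "to_circle ` {a<..<b} \<inter> S = {}"
    then obtain m c where mc: "\<forall>x\<in>{a<..<b}. F x = m * x + c" using S(2) by blast
    show "\<exists>k::int. \<exists>c. \<forall>x\<in>{a<..<b}. F x = 2 powi k * x + c"
    proof (cases "a < b")
      case True
      have "((\<lambda>x. m * x + c) has_real_derivative m) (at ((a + b) / 2))"
        by (auto intro!: derivative_eq_intros)
      then have "(F has_real_derivative m) (at ((a + b) / 2))"
        by (rule has_field_derivative_transform_within_open[of _ _ _ "{a<..<b}"])
           (use mc True in auto)
      then obtain k :: int where "m = 2 powi k" using deriv by blast
      then show ?thesis using mc by blast
    qed simp
  next
    fix x assume "x \<in> dyadic"
    then have "to_circle (F x) \<in> to_circle ` dyadic" using dy lift by (metis imageI subsetD)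
    then obtain y n where "y \<in> dyadic" "F x = y + of_int n" by (auto simp: to_circle_eq_iff)
    then show "F x \<in> dyadic" by (simp add: dyadic_add)
  qed (use lift cont mono S(1) in auto)
  then show ?thesis by (rule that)
qed

lemma bij_thompson: "f \<in> carrier thompson_T \<Longrightarrow> bij f"
  by (auto simp: thompson_T_def homeomorphism_def fun_eq_iff intro: o_bij)

lemma thompson_has_fixing_lift:
  assumes f: "f \<in> carrier thompson_T" and fixed: "f (to_circle z) = to_circle z"
  obtains F S where "thompson_lift f F S" "F z = z"
proof -
  obtain F S where FS: "thompson_lift f F S" using thompson_has_lift[OF f] .
  then obtain n where "F z = z + of_int n"
    using fixed by (auto simp: thompson_lift.lift to_circle_eq_iff)
  then show ?thesis using thompson_lift.translate[OF FS, of "- n"] that[of "\<lambda>x. F x + of_int (- n)" S] by simp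
qed

text \<open>A lift with a fixed point preserves all unit intervals between translates of this point,
  so it does not translate any of the other lifted fixed points.\<close>

lemma (in thompson_lift) fixed_point_iff:
  assumes "F z = z"
  shows "f (to_circle x) = to_circle x \<longleftrightarrow> F x = x"
proof
  assume "f (to_circle x) = to_circle x"
  then obtain n where n: "F x = x + of_int n" by (auto simp: lift to_circle_eq_iff)
  define m where "m = \<lfloor>x - z\<rfloor>"
  have m: "z + of_int m \<le> x" "x < z + of_int (m + 1)"
    unfolding m_def by (simp_all, linarith+)
  then have "z + of_int m \<le> F x" "F x < z + of_int (m + 1)"
    using lift_add_int[of z m] lift_add_int[of z "m + 1"] assms mono
    by (metis strict_mono_less_eq, metis strict_mono_less)
  then have "n = 0" using m n by simp
  then show "F x = x" using n by simp
qed (simp add: lift)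

text \<open>The points of the circle enter through representatives \<open>x\<close> and \<open>y\<close> on the line. In this way the
  slope is expressed without a choice of lift, and the chain rule needs no commuting lifts.\<close>

definition germ :: "(circle \<Rightarrow> circle) \<Rightarrow> real \<Rightarrow> real \<Rightarrow> int \<Rightarrow> bool" where
  "germ f x y k \<longleftrightarrow> (\<exists>e>0. \<forall>h\<in>{0..<e}. f (to_circle (x + h)) = to_circle (y + 2 powi k * h))"

lemma germ_exists:
  assumes f: "f \<in> carrier thompson_T" and xy: "f (to_circle x) = to_circle y"
  obtains k where "germ f x y k"
proof -
  obtain F S where "thompson_lift f F S" using thompson_has_lift[OF f] .
  then interpret thompson_lift f F S .
  obtain n where n: "F x = y + of_int n" using xy by (auto simp: lift to_circle_eq_iff)
  obtain e where e: "e > 0" "\<forall>h\<in>{0..<e}. F (x + h) = F x + 2 powi slope x * h"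
    using right_germ by blast
  have "f (to_circle (x + h)) = to_circle (y + 2 powi slope x * h)" if "h \<in> {0..<e}" for h
    using that e(2) n to_circle_add_int[of "y + 2 powi slope x * h" n]
    by (simp add: lift algebra_simps)
  then have "germ f x y (slope x)" unfolding germ_def using e(1) by blast
  then show ?thesis by (rule that)
qed

lemma germ_comp:
  assumes "germ f x y k" "germ g y z l"
  shows "germ (g \<circ> f) x z (k + l)"
proof -
  obtain d where d: "d > 0" "\<forall>h\<in>{0..<d}. f (to_circle (x + h)) = to_circle (y + 2 powi k * h)"
    using assms(1) by (auto simp: germ_def)
  obtain e where e: "e > 0" "\<forall>h\<in>{0..<e}. g (to_circle (y + h)) = to_circle (z + 2 powi l * h)"
    using assms(2) by (auto simp: germ_def)
  define c where "c = min d (e / 2 powi k)"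
  have c: "c > 0" "c \<le> d" "c \<le> e / 2 powi k" using d(1) e(1) by (auto simp: c_def)
  have "(g \<circ> f) (to_circle (x + h)) = to_circle (z + 2 powi (k + l) * h)" if h: "h \<in> {0..<c}" for h
  proof -
    have "h < e / 2 powi k" using h c(3) by auto
    then have "2 powi k * h < e" by (simp add: field_simps)
    then have "2 powi k * h \<in> {0..<e}" using h by simp
    then have "g (to_circle (y + 2 powi k * h)) = to_circle (z + 2 powi l * (2 powi k * h))"
      using e(2) by blast
    moreover have "f (to_circle (x + h)) = to_circle (y + 2 powi k * h)" using d(2) h c(2) by auto
    ultimately show ?thesis by (simp add: power_int_add ac_simps)
  qed
  then show ?thesis unfolding germ_def using c(1) by blast
qed

lemma germ_inverse:
  assumes "germ f x y k" and inv: "\<And>p. g (f p) = p"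
  shows "germ g y x (- k)"
proof -
  obtain d where d: "d > 0" "\<forall>h\<in>{0..<d}. f (to_circle (x + h)) = to_circle (y + 2 powi k * h)"
    using assms(1) by (auto simp: germ_def)
  have "g (to_circle (y + h)) = to_circle (x + 2 powi (- k) * h)" if h: "h \<in> {0..<2 powi k * d}" for h
  proof -
    have u: "2 powi (- k) * h \<in> {0..<d}" using h by (auto simp: power_int_minus field_simps)
    have "2 powi k * (2 powi (- k) * h) = h" by (simp add: power_int_minus)
    then have "f (to_circle (x + 2 powi (- k) * h)) = to_circle (y + h)"
      using d(2) u by (metis)
    then show ?thesis using inv by metis
  qed
  then show ?thesis unfolding germ_def using d(1)
    by (intro exI[of _ "2 powi k * d"]) auto
qed

lemma germ_translate: "germ f x y k \<Longrightarrow> germ f (x + of_int n) (y + of_int m) k"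
  unfolding germ_def using to_circle_add_int by (metis add.assoc add.commute)

text \<open>The fixed points which are left endpoints of an interval of points moved by \<open>f\<close>.\<close>

definition departures :: "(circle \<Rightarrow> circle) \<Rightarrow> circle set" where
  "departures f = {p. f p = p \<and> (\<forall>x. to_circle x = p \<longrightarrow> \<not> germ f x x 0)}"

lemma to_circle_in_departures:
  "to_circle x \<in> departures f \<longleftrightarrow> f (to_circle x) = to_circle x \<and> \<not> germ f x x 0"
  unfolding departures_def using germ_translate[of f _ _ 0]
  by (auto simp: to_circle_eq_iff) (metis add.commute diff_add_cancel of_int_minus uminus_add_conv_diff)

text \<open>An affine piece of the lift contains at most one departure, so departures do not
  accumulate.\<close>

lemma finite_departures:
  assumes f: "f \<in> carrier thompson_T" and fixed: "f q = q"
  shows "finite (departures f)"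
proof -
  obtain z where "q = to_circle z" by (rule to_circle_cases)
  then obtain F S where FS: "thompson_lift f F S" "F z = z"
    using thompson_has_fixing_lift[OF f] fixed by metis
  interpret thompson_lift f F S by (rule FS(1))
  have piece: "finite {x. a < x \<and> x < b \<and> to_circle x \<in> departures f}"
    if aff: "\<And>x. a < x \<Longrightarrow> x < b \<Longrightarrow> F x = 2 powi k * x + c" for a b k c
  proof (rule finite_subset)
    show "{x. a < x \<and> x < b \<and> to_circle x \<in> departures f} \<subseteq> {c / (1 - 2 powi k)}"
    proof clarify
      fix x assume x: "a < x" "x < b" "to_circle x \<in> departures f"
      then have Fx: "2 powi k * x + c = x"
        using aff fixed_point_iff[OF FS(2)] by (auto simp: to_circle_in_departures)
      have "2 powi k \<noteq> (1::real)"
        \<comment> \<open>a fixed point in an affine piece of slope 1 has a neighbourhood of fixed points\<close>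
      proof
        assume one: "2 powi k = (1::real)"
        then have "c = 0" using Fx by simp
        then have "germ f x x 0"
          unfolding germ_def using x(1,2) aff one by (intro exI[of _ "b - x"]) (auto simp: lift)
        then show False using x(3) by (simp add: to_circle_in_departures)
      qed
      then show "x = c / (1 - 2 powi k)" using Fx by (simp add: field_simps)
    qed
  qed simp
  have "finite {x\<in>{0..1}. to_circle x \<in> departures f}"
  proof (rule Bolzano[where P = "\<lambda>a b. finite {x\<in>{a..b}. to_circle x \<in> departures f}"])
    fix a b c :: real
    assume "finite {x\<in>{a..b}. to_circle x \<in> departures f}" "finite {x\<in>{b..c}. to_circle x \<in> departures f}"
    then show "finite {x\<in>{a..c}. to_circle x \<in> departures f}"
      by (rule finite_subset[OF _ finite_UnI, rotated]) auto
  next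
    fix x0 :: real
    obtain e k c k' c' where e: "e > 0"
      "\<And>x. x0 \<le> x \<Longrightarrow> x < x0 + e \<Longrightarrow> F x = 2 powi k * x + c"
      "\<And>x. x0 - e < x \<Longrightarrow> x < x0 \<Longrightarrow> F x = 2 powi k' * x + c'"
      using affine_pieces by metis
    have "finite (insert x0 ({x. x0 < x \<and> x < x0 + e \<and> to_circle x \<in> departures f} \<union>
        {x. x0 - e < x \<and> x < x0 \<and> to_circle x \<in> departures f}))"
      (is "finite ?E")
      using piece[of x0 "x0 + e" k c] piece[of "x0 - e" x0 k' c'] e by simp
    moreover have "{x\<in>{a..b}. to_circle x \<in> departures f} \<subseteq> ?E"
      if "a \<le> x0 \<and> x0 \<le> b \<and> b - a < e" for a b
    proof
      fix x assume "x \<in> {x\<in>{a..b}. to_circle x \<in> departures f}"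
      then show "x \<in> ?E" using that by (cases x x0 rule: linorder_cases) auto
    qed
    ultimately have "finite {x\<in>{a..b}. to_circle x \<in> departures f}"
      if "a \<le> x0 \<and> x0 \<le> b \<and> b - a < e" for a b
      using that finite_subset by blast
    then show "\<exists>d>0. \<forall>a b. a \<le> x0 \<and> x0 \<le> b \<and> b - a < d \<longrightarrow>
        finite {x\<in>{a..b}. to_circle x \<in> departures f}"
      using e(1) by blast
  qed simp
  moreover have "departures f \<subseteq> to_circle ` {x\<in>{0..1}. to_circle x \<in> departures f}"
  proof
    fix p assume p: "p \<in> departures f"
    obtain x where "p = to_circle x" by (rule to_circle_cases)
    then have "p = to_circle (frac x)" using to_circle_add_int[of "frac x" "\<lfloor>x\<rfloor>"] by (simp add: frac_def)
    then show "p \<in> to_circle ` {x\<in>{0..1}. to_circle x \<in> departures f}"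
      using p frac_lt_1[of x] by (intro image_eqI[of _ _ "frac x"]) auto
  qed
  ultimately show ?thesis by (meson finite_imageI finite_subset)
qed

text \<open>A moved point can be pushed by the iterates of \<open>f\<close> or of its inverse arbitrarily close to the
  next departure on its left. A map that commutes with \<open>f\<close> and is trivial next to this departure
  therefore fixes the point.\<close>

lemma departure_controls_centralizer:
  assumes f: "f \<in> carrier thompson_T" and fixed: "f q = q" and moved: "f p \<noteq> p"
  obtains c where "to_circle c \<in> departures f"
    "\<And>v. (\<And>r. v (f r) = f (v r)) \<Longrightarrow> germ v c c 0 \<Longrightarrow> v p = p"
proof -
  obtain z where "q = to_circle z" by (rule to_circle_cases)
  then obtain F S where FS: "thompson_lift f F S" "F z = z"
    using thompson_has_fixing_lift[OF f] fixed by metis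
  interpret thompson_lift f F S by (rule FS(1))
  obtain x where x: "p = to_circle x" by (rule to_circle_cases)
  define A where "A = {w. w \<le> x \<and> F w = w}"
  have "z + of_int \<lfloor>x - z\<rfloor> \<le> x" by linarith
  then have A_ne: "A \<noteq> {}" using lift_add_int[of z "\<lfloor>x - z\<rfloor>"] FS(2) by (auto simp: A_def)
  have A_bdd: "bdd_above A" by (intro bdd_aboveI[of _ x]) (auto simp: A_def)
  have "closed A"
    unfolding A_def using cont
    by (intro closed_Collect_conj closed_Collect_le closed_Collect_eq continuous_intros) auto
  define c where "c = Sup A"
  have "c \<in> A" unfolding c_def by (rule closed_contains_Sup) fact+
  then have c: "F c = c" "c \<le> x" by (auto simp: A_def)
  have no_fixed: "F w \<noteq> w" if "c < w" "w \<le> x" for w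
    using cSup_upper[OF _ A_bdd, of w] that by (auto simp: A_def c_def)
  have "F x \<noteq> x" using moved fixed_point_iff[OF FS(2)] x by simp
  then have "c < x" using c by (cases "c = x") auto
  have "\<not> germ f c c 0"
  proof
    assume "germ f c c 0"
    then obtain e where e: "e > 0" "\<forall>h\<in>{0..<e}. f (to_circle (c + h)) = to_circle (c + h)"
      by (auto simp: germ_def)
    define h where "h = min e (x - c) / 2"
    have h: "0 < h" "h < e" "c + h \<le> x" using e(1) \<open>c < x\<close> by (auto simp: h_def min_def field_simps)
    then have "F (c + h) = c + h" using e(2) fixed_point_iff[OF FS(2)] by auto
    then show False using no_fixed[of "c + h"] h by simp
  qed
  then have "to_circle c \<in> departures f" using c by (simp add: to_circle_in_departures lift)
  moreover have "v p = p" if comm: "\<And>r. v (f r) = f (v r)" and germ: "germ v c c 0" for v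
  proof -
    obtain e where e: "e > 0" "\<forall>h\<in>{0..<e}. v (to_circle (c + h)) = to_circle (c + h)"
      using germ by (auto simp: germ_def)
    have near: "v (to_circle w) = to_circle w" if "c \<le> w" "w < c + e" for w
      using e(2)[rule_format, of "w - c"] that by simp
    have comm_pow: "v ((f ^^ k) r) = (f ^^ k) (v r)" for k r
      by (induction k) (simp_all add: comm)
    have F_pow_c: "c \<le> (F ^^ k) w" if "c \<le> w" for k w
    proof (induction k)
      case (Suc k)
      then show ?case using mono c(1) by (metis comp_apply funpow.simps(2) strict_mono_less_eq)
    qed (use that in simp)
    show "v p = p"
    proof (cases "F x < x")
      case True
      obtain L where L: "c \<le> L" "L < x" "F L = L" "\<And>u. L < u \<Longrightarrow> \<exists>k. (F ^^ k) x < u"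
        using decreasing_orbit_inf[OF mono surj_lift True, of c] F_pow_c c(2) by blast
      then have "L = c" using no_fixed[of L] by force
      then obtain k where "(F ^^ k) x < c + e" using L(4)[of "c + e"] e(1) by auto
      then have "v ((f ^^ k) p) = (f ^^ k) p" using near F_pow_c c(2) by (simp add: x lift_pow)
      then have "(f ^^ k) (v p) = (f ^^ k) p" by (simp add: comm_pow)
      moreover have "inj (f ^^ k)" using bij_thompson[OF f] by (simp add: bij_is_inj inj_fn)
      ultimately show ?thesis by (simp add: inj_eq)
    next
      case False
      define G where "G = inv_into UNIV F"
      have FG: "F (G w) = w" for w unfolding G_def by (rule surj_f_inv_f[OF surj_lift])
      have mono_G: "strict_mono G"
        using mono FG by (intro strict_monoI) (metis strict_mono_less)
      have surj_G: "surj G" unfolding G_def using inj_lift by (rule inj_imp_surj_inv)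
      have "F (G x) < F x" using False \<open>F x \<noteq> x\<close> FG by simp
      then have less: "G x < x" using mono by (simp add: strict_mono_less)
      have G_c: "G c = c" using c(1) inj_lift unfolding G_def by (metis inv_f_f)
      have G_pow_c: "c \<le> (G ^^ k) x" for k
      proof (induction k)
        case (Suc k)
        then show ?case using mono_G G_c by (metis comp_apply funpow.simps(2) strict_mono_less_eq)
      qed (use c(2) in simp)
      obtain L where L: "c \<le> L" "L < x" "G L = L" "\<And>u. L < u \<Longrightarrow> \<exists>k. (G ^^ k) x < u"
        using decreasing_orbit_inf[OF mono_G surj_G less, of c] G_pow_c by blast
      then have "L = c" using no_fixed[of L] FG[of L] by force
      then obtain k where k: "(G ^^ k) x < c + e" using L(4)[of "c + e"] e(1) by auto
      have "(F ^^ k) ((G ^^ k) x) = x"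
      proof (induction k)
        case (Suc k)
        then show ?case by (subst funpow_Suc_right) (simp add: FG)
      qed simp
      then have p: "p = (f ^^ k) (to_circle ((G ^^ k) x))" by (simp add: x lift_pow)
      then have "v p = (f ^^ k) (v (to_circle ((G ^^ k) x)))" by (simp add: comm_pow)
      also have "\<dots> = p" using near G_pow_c k p by simp
      finally show ?thesis .
    qed
  qed
  ultimately show ?thesis by (rule that)
qed

text \<open>Commuting maps permute each other's departures, of which there are finitely many. A map with a
  fixed point has no other periodic points, so it cannot permute them nontrivially.\<close>

lemma commuting_fixes_departures:
  assumes f: "f \<in> carrier thompson_T" "f q = q" and g: "g \<in> carrier thompson_T" "g r = r"
    and comm: "\<And>x. f (g x) = g (f x)"
    and p: "p \<in> departures f"
  shows "g p = p"
proof -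
  have invariant: "g s \<in> departures f" if s: "s \<in> departures f" for s
  proof -
    obtain x where x: "s = to_circle x" by (rule to_circle_cases)
    obtain y where y: "g s = to_circle y" by (rule to_circle_cases)
    obtain k where k: "germ g x y k" using germ_exists[OF g(1)] x y by metis
    define g' where "g' = inv_into UNIV g"
    have g': "g' (g w) = w" for w
      unfolding g'_def using bij_is_inj[OF bij_thompson[OF g(1)]] by (rule inv_f_f)
    have "\<not> germ f y y 0"
    proof
      assume "germ f y y 0"
      then have "germ (g' \<circ> (f \<circ> g)) x x (k + 0 + - k)"
        by (intro germ_comp[OF germ_comp[OF k] germ_inverse[OF k g']])
      moreover have "g' \<circ> (f \<circ> g) = f" by (auto simp: comm g')
      ultimately show False using s x by (simp add: to_circle_in_departures)
    qed
    moreover have "f (g s) = g s" using s by (simp add: comm departures_def)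
    ultimately show ?thesis unfolding y by (simp add: to_circle_in_departures)
  qed
  have orbit: "(g ^^ n) p \<in> departures f" for n
    by (induction n) (use p invariant in auto)
  obtain z where "r = to_circle z" by (rule to_circle_cases)
  then obtain G S where GS: "thompson_lift g G S" "G z = z"
    using thompson_has_fixing_lift[OF g(1)] g(2) by metis
  interpret thompson_lift g G S by (rule GS(1))
  obtain x where x: "p = to_circle x" by (rule to_circle_cases)
  define m where "m = \<lfloor>x - z\<rfloor>"
  have G_fix: "G (z + of_int l) = z + of_int l" for l using lift_add_int[of z l] GS(2) by simp
  \<comment> \<open>the lifted orbit of \<open>x\<close> stays between two adjacent translates of \<open>z\<close>, so it cannot close up on
    the circle without closing up on the line\<close>
  have range: "z + of_int m \<le> (G ^^ n) x \<and> (G ^^ n) x < z + of_int (m + 1)" for n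
  proof (induction n)
    case 0
    show ?case unfolding m_def by (simp, linarith)
  next
    case (Suc n)
    then show ?case using G_fix[of m] G_fix[of "m + 1"] mono
      by (metis comp_apply funpow.simps(2) strict_mono_less strict_mono_less_eq)
  qed
  show ?thesis
  proof (rule ccontr)
    assume "g p \<noteq> p"
    then have "G x \<noteq> x" by (auto simp: x lift)
    have step: "(G ^^ Suc n) x = (G ^^ n) (G x)" for n by (simp add: funpow_swap1)
    have inj: "inj (\<lambda>n. (G ^^ n) x)"
    proof (cases "x < G x")
      case True
      then have "(G ^^ n) x < (G ^^ Suc n) x" for n
        unfolding step using strict_mono_funpow[OF mono] by (rule strict_monoD[rotated])
      then have "strict_mono (\<lambda>n. (G ^^ n) x)" by (intro strict_mono_Suc_iff[THEN iffD2]) auto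
      then show ?thesis by (rule strict_mono_imp_inj_on)
    next
      case False
      then have "G x < x" using \<open>G x \<noteq> x\<close> by simp
      then have "(G ^^ Suc n) x < (G ^^ n) x" for n
        unfolding step using strict_mono_funpow[OF mono] by (rule strict_monoD[rotated])
      then have "strict_mono (\<lambda>n. - (G ^^ n) x)" by (intro strict_mono_Suc_iff[THEN iffD2]) auto
      then have "inj (\<lambda>n. - (G ^^ n) x)" by (rule strict_mono_imp_inj_on)
      then show ?thesis by (simp add: inj_on_def)
    qed
    have "inj (\<lambda>n. (g ^^ n) p)"
    proof (rule injI)
      fix i j assume "(g ^^ i) p = (g ^^ j) p"
      then have "(G ^^ i) x = (G ^^ j) x"
        using range[of i] range[of j] by (intro to_circle_inj_near) (auto simp: x lift_pow)
      then show "i = j" by (rule injD[OF inj])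
    qed
    then have "infinite (range (\<lambda>n. (g ^^ n) p))" by (rule range_inj_infinite)
    moreover have "range (\<lambda>n. (g ^^ n) p) \<subseteq> departures f" using orbit by auto
    ultimately show False using finite_departures[OF f] by (meson finite_subset)
  qed
qed

lemma departures_nonempty:
  assumes "f \<in> carrier thompson_T" "f q = q" "f \<noteq> id"
  shows "departures f \<noteq> {}"
proof -
  obtain p where "f p \<noteq> p" using assms(3) by (auto simp: fun_eq_iff)
  then show ?thesis using departure_controls_centralizer[OF assms(1,2)] by blast
qed

lemma thompson_has_periodic_point:
  assumes "f \<in> carrier thompson_T"
  obtains n p where "n > 0" "(f ^^ n) p = p"
  using thompson_has_lift[OF assms] thompson_lift.has_periodic_point by metis

section \<open>Actions of the wreath product\<close>

abbreviation finsupp :: "(int \<times> int \<Rightarrow> int) \<Rightarrow> bool" where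
  "finsupp b \<equiv> finite {t. b t \<noteq> 0}"

lemma carrier_ZW2: "(b, u) \<in> carrier ZW2 \<longleftrightarrow> finsupp b"
  by (simp add: ZW2_def wreath_def carrier_sum_group DirProd_def)

lemma mult_ZW2: "(a, u) \<otimes>\<^bsub>ZW2\<^esub> (b, v) = (\<lambda>t. a t + b (t + u), u + v)"
  by (simp add: ZW2_def wreath_def DirProd_def plus_prod_def case_prod_unfold restrict_UNIV)

lemma finsupp_add: "finsupp a \<Longrightarrow> finsupp b \<Longrightarrow> finsupp (\<lambda>t. a t + b t)"
  by (rule finite_subset[of _ "{t. a t \<noteq> 0} \<union> {t. b t \<noteq> 0}"]) auto

lemma finsupp_shift: "finsupp b \<Longrightarrow> finsupp (\<lambda>t. b (t + v))"
  using finite_vimageI[of "{t. b t \<noteq> 0}" "\<lambda>t. t + v"] by (simp add: vimage_def)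

text \<open>The support would contain an infinite arithmetic progression.\<close>

lemma finsupp_shift_invariant:
  assumes "finsupp b" "v \<noteq> 0" and inv: "\<And>t. b (t + v) = b t"
  shows "b = (\<lambda>_. 0)"
proof
  fix t show "b t = 0"
  proof (rule ccontr)
    assume "b t \<noteq> 0"
    define s where "s n = t + (int n * fst v, int n * snd v)" for n
    have "b (s n) \<noteq> 0" for n
    proof (induction n)
      case 0
      then show ?case using \<open>b t \<noteq> 0\<close> by (simp add: s_def flip: zero_prod_def)
    next
      case (Suc n)
      have "s (Suc n) = s n + v" by (simp add: s_def plus_prod_def algebra_simps)
      then show ?case using Suc inv by simp
    qed
    then have "range s \<subseteq> {t. b t \<noteq> 0}" by auto
    moreover have "inj s"
      using \<open>v \<noteq> 0\<close> by (auto simp: inj_def s_def plus_prod_def prod_eq_iff)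
    then have "infinite (range s)" by (rule range_inj_infinite)
    ultimately show False using assms(1) finite_subset by blast
  qed
qed

locale ZW2_in_thompson =
  fixes \<phi> :: "(int \<times> int \<Rightarrow> int) \<times> (int \<times> int) \<Rightarrow> circle \<Rightarrow> circle"
  assumes mon: "\<phi> \<in> mon ZW2 thompson_T"
begin

lemma in_T: "finsupp b \<Longrightarrow> \<phi> (b, u) \<in> carrier thompson_T"
  using mon by (auto simp: mon_def hom_def carrier_ZW2)

lemma mult: "finsupp a \<Longrightarrow> finsupp b \<Longrightarrow>
    \<phi> (a, u) (\<phi> (b, v) p) = \<phi> (\<lambda>t. a t + b (t + u), u + v) p"
proof -
  assume "finsupp a" "finsupp b"
  then have "\<phi> ((a, u) \<otimes>\<^bsub>ZW2\<^esub> (b, v)) = \<phi> (a, u) \<otimes>\<^bsub>thompson_T\<^esub> \<phi> (b, v)"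
    using mon unfolding mon_def by (intro hom_mult[of \<phi>]) (auto simp: carrier_ZW2)
  then show ?thesis by (simp add: mult_ZW2 thompson_T_def)
qed

lemma one: "\<phi> (\<lambda>_. 0, 0) p = p"
proof -
  have "inj (\<phi> (\<lambda>_. 0, 0))" by (intro bij_is_inj bij_thompson in_T) simp
  moreover have "\<phi> (\<lambda>_. 0, 0) (\<phi> (\<lambda>_. 0, 0) p) = \<phi> (\<lambda>_. 0, 0) p"
    using mult[of "\<lambda>_. 0" "\<lambda>_. 0" 0 0 p] by simp
  ultimately show ?thesis by (simp add: inj_eq)
qed

definition base_act :: "(int \<times> int \<Rightarrow> int) \<Rightarrow> circle \<Rightarrow> circle" where
  "base_act b = \<phi> (b, 0)"

definition top_act :: "int \<times> int \<Rightarrow> circle \<Rightarrow> circle" where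
  "top_act v = \<phi> (\<lambda>_. 0, v)"

lemma base_in_T: "finsupp b \<Longrightarrow> base_act b \<in> carrier thompson_T"
  by (simp add: base_act_def in_T)

lemma top_in_T: "top_act v \<in> carrier thompson_T"
  by (simp add: top_act_def in_T)

lemma base_add: "finsupp a \<Longrightarrow> finsupp b \<Longrightarrow> base_act a (base_act b p) = base_act (\<lambda>t. a t + b t) p"
  by (simp add: base_act_def mult)

lemma base_0: "base_act (\<lambda>_. 0) p = p"
  by (simp add: base_act_def one)

lemma base_nontrivial:
  assumes "finsupp b" "b \<noteq> (\<lambda>_. 0)"
  shows "base_act b \<noteq> id"
proof
  assume "base_act b = id"
  then have "\<phi> (b, 0) = \<phi> (\<lambda>_. 0, 0)" by (simp add: base_act_def one fun_eq_iff)
  moreover have "inj_on \<phi> (carrier ZW2)" using mon by (simp add: mon_def)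
  moreover have "(b, 0) \<in> carrier ZW2" "(\<lambda>_. 0, 0) \<in> carrier ZW2"
    using assms(1) by (simp_all add: carrier_ZW2)
  ultimately have "(b, 0) = (\<lambda>_. 0, 0 :: int \<times> int)" by (metis inj_onD)
  then show False using assms(2) by simp
qed

lemma base_commute: "finsupp a \<Longrightarrow> finsupp b \<Longrightarrow> base_act a (base_act b p) = base_act b (base_act a p)"
  by (simp add: base_add add.commute)

lemma base_uminus: "finsupp b \<Longrightarrow> base_act (\<lambda>t. - b t) (base_act b p) = p"
  by (simp add: base_add base_0)

lemma top_add: "top_act u (top_act v p) = top_act (u + v) p"
  by (simp add: top_act_def mult)

lemma top_0: "top_act 0 p = p"
  by (simp add: top_act_def one)

lemma top_uminus: "top_act (- v) (top_act v p) = p" "top_act v (top_act (- v) p) = p"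
  by (simp_all add: top_add top_0)

lemma top_commute: "top_act u (top_act v p) = top_act v (top_act u p)"
  by (simp add: top_add add.commute)

lemma top_base: "finsupp b \<Longrightarrow> top_act v (base_act b p) = base_act (\<lambda>t. b (t + v)) (top_act v p)"
  by (simp add: top_act_def base_act_def mult finsupp_shift)

lemma base_pow: "finsupp b \<Longrightarrow> (base_act b ^^ n) = base_act (\<lambda>t. int n * b t)"
proof (induction n)
  case 0
  show ?case by (simp add: base_0 fun_eq_iff)
next
  case (Suc n)
  have "finsupp (\<lambda>t. int n * b t)" using Suc.prems by (rule rev_finite_subset) auto
  then show ?case using Suc by (simp add: fun_eq_iff base_add algebra_simps)
qed

lemma top_pow: "(top_act (a, b) ^^ n) = top_act (int n * a, int n * b)"
proof (induction n)
  case 0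
  show ?case using top_0 by (simp add: fun_eq_iff zero_prod_def)
qed (simp add: fun_eq_iff top_add algebra_simps)

text \<open>The elements of the base group that have a fixed point form a subgroup, which is normalized
  by the top group: their departures are common fixed points.\<close>

definition rooted :: "(int \<times> int \<Rightarrow> int) \<Rightarrow> bool" where
  "rooted b \<longleftrightarrow> finsupp b \<and> (\<exists>p. base_act b p = p)"

lemma rooted_fixes_departures:
  assumes "rooted a" "rooted b" "p \<in> departures (base_act a)"
  shows "base_act b p = p"
proof -
  obtain q r where "finsupp a" "base_act a q = q" "finsupp b" "base_act b r = r"
    using assms(1,2) by (auto simp: rooted_def)
  then show ?thesis
    using commuting_fixes_departures[of "base_act a" q "base_act b" r p] assms(3)
    by (simp add: base_in_T base_commute)
qed

lemma rooted_add:
  assumes "rooted a" "rooted b"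
  shows "rooted (\<lambda>t. a t + b t)"
proof -
  obtain q r where qr: "finsupp a" "base_act a q = q" "finsupp b" "base_act b r = r"
    using assms by (auto simp: rooted_def)
  \<comment> \<open>a departure of \<open>a\<close> is fixed by \<open>b\<close> as well\<close>
  have "\<exists>p. base_act a p = p \<and> base_act b p = p"
  proof (cases "base_act a = id")
    case False
    then obtain p where "p \<in> departures (base_act a)"
      using departures_nonempty[OF base_in_T] qr by blast
    then show ?thesis using rooted_fixes_departures assms by blast
  qed (use qr in auto)
  then obtain p where "base_act a (base_act b p) = p" by metis
  then show ?thesis using qr finsupp_add[of a b] by (auto simp: rooted_def base_add)
qed

lemma rooted_uminus:
  assumes "rooted b"
  shows "rooted (\<lambda>t. - b t)"
proof -
  obtain p where p: "finsupp b" "base_act b p = p" using assms by (auto simp: rooted_def)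
  then have "base_act (\<lambda>t. - b t) p = p" using base_uminus[of b p] by simp
  then show ?thesis using p(1) by (auto simp: rooted_def)
qed

lemma rooted_shift:
  assumes "rooted b"
  shows "rooted (\<lambda>t. b (t + v))"
proof -
  obtain p where p: "finsupp b" "base_act b p = p" using assms by (auto simp: rooted_def)
  then have "base_act (\<lambda>t. b (t + v)) (top_act v p) = top_act v p" using top_base[of b v p] by simp
  then show ?thesis using finsupp_shift[OF p(1)] by (auto simp: rooted_def)
qed

lemma rooted_diff: "rooted b \<Longrightarrow> rooted (\<lambda>t. b (t + v) - b t)"
  using rooted_add[OF rooted_shift rooted_uminus, of b b v] by simp

lemma exists_rooted: "\<exists>b. rooted b \<and> b \<noteq> (\<lambda>_. 0)"
proof -
  define d where "d t = (if t = 0 then 1 else 0 :: int)" for t :: "int \<times> int"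
  have fin: "finsupp d" by (simp add: d_def)
  obtain n p where n: "n > 0" "(base_act d ^^ n) p = p"
    using thompson_has_periodic_point[OF base_in_T[OF fin]] .
  have "rooted (\<lambda>t. int n * d t)"
    using n(2) fin by (auto simp: rooted_def base_pow d_def)
  moreover have "int n * d 0 \<noteq> 0" using n(1) by (simp add: d_def)
  ultimately show ?thesis by metis
qed

definition common_fixed :: "circle set" where
  "common_fixed = {p. \<forall>b. rooted b \<longrightarrow> base_act b p = p}"

lemma top_common_fixed:
  assumes "p \<in> common_fixed"
  shows "top_act v p \<in> common_fixed"
  unfolding common_fixed_def
proof clarify
  fix b assume b: "rooted b"
  have "rooted (\<lambda>t. b (t + - v))" using b by (rule rooted_shift)
  then have "top_act v (base_act (\<lambda>t. b (t + - v)) p) = top_act v p" and "finsupp (\<lambda>t. b (t + - v))"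
    using assms by (auto simp: common_fixed_def rooted_def)
  then show "base_act b (top_act v p) = top_act v p" using top_base[of "\<lambda>t. b (t + - v)" v p] by (simp add: add.assoc)
qed

text \<open>Conjugation by an element that fixes a point does not change the slope there, so the commutator
  has slope 1.\<close>

lemma germ_commutator:
  assumes b: "rooted b" and x: "to_circle x \<in> common_fixed" "top_act v (to_circle x) = to_circle x"
  shows "germ (base_act (\<lambda>t. b (t + v) - b t)) x x 0"
proof -
  have fin: "finsupp b" using b by (simp add: rooted_def)
  obtain j where j: "germ (top_act v) x x j" using germ_exists[OF top_in_T x(2)] .
  have "base_act b (to_circle x) = to_circle x" using b x(1) by (simp add: common_fixed_def)
  then obtain k where k: "germ (base_act b) x x k" using germ_exists[OF base_in_T[OF fin]] by blast
  have "germ (base_act (\<lambda>t. - b t) \<circ> (top_act v \<circ> (base_act b \<circ> top_act (- v)))) x x (- j + k + j + - k)"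
    using fin by (intro germ_comp[of _ _ x] germ_inverse[OF j] germ_inverse[OF k] j k)
      (simp_all add: top_uminus base_uminus)
  moreover have "base_act (\<lambda>t. - b t) \<circ> (top_act v \<circ> (base_act b \<circ> top_act (- v))) = base_act (\<lambda>t. b (t + v) - b t)"
    using fin finsupp_shift[OF fin, of v]
    by (auto simp: fun_eq_iff top_base top_uminus base_add)
  ultimately show ?thesis by simp
qed

text \<open>Triviality next to the common fixed points which \<open>w\<close> fixes is preserved when further
  commutators are taken.\<close>

definition quiet :: "(int \<times> int \<Rightarrow> int) \<Rightarrow> int \<times> int \<Rightarrow> bool" where
  "quiet b w \<longleftrightarrow> (\<forall>x. to_circle x \<in> common_fixed \<longrightarrow> top_act w (to_circle x) = to_circle x \<longrightarrow>
     germ (base_act b) x x 0)"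

lemma quiet_diff:
  assumes "finsupp b" "quiet b w"
  shows "quiet (\<lambda>t. b (t + v) - b t) w"
  unfolding quiet_def
proof clarify
  fix x assume x: "to_circle x \<in> common_fixed" "top_act w (to_circle x) = to_circle x"
  obtain y where y: "top_act (- v) (to_circle x) = to_circle y" by (metis to_circle_cases)
  have "to_circle y \<in> common_fixed" using top_common_fixed[OF x(1), of "- v"] y by simp
  moreover have "top_act w (to_circle y) = to_circle y" using x(2) y by (metis top_commute)
  ultimately have gy: "germ (base_act b) y y 0" using assms(2) by (simp add: quiet_def)
  have gx: "germ (base_act b) x x 0" using assms(2) x by (simp add: quiet_def)
  obtain j where j: "germ (top_act (- v)) x y j" using germ_exists[OF top_in_T y] .
  have "germ (base_act (\<lambda>t. - b t) \<circ> (top_act v \<circ> (base_act b \<circ> top_act (- v)))) x x (j + 0 + - j + - 0)"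
    using assms(1) by (intro germ_comp[OF germ_comp[OF germ_comp[OF j gy] germ_inverse[OF j]]
          germ_inverse[OF gx]]) (simp_all add: top_uminus base_uminus)
  moreover have "base_act (\<lambda>t. - b t) \<circ> (top_act v \<circ> (base_act b \<circ> top_act (- v))) = base_act (\<lambda>t. b (t + v) - b t)"
    using assms(1) finsupp_shift[OF assms(1), of v]
    by (auto simp: fun_eq_iff top_base top_uminus base_add)
  ultimately show "germ (base_act (\<lambda>t. b (t + v) - b t)) x x 0" by simp
qed

lemma exists_quiet:
  assumes "finite W" "0 \<notin> W"
  shows "\<exists>b. rooted b \<and> b \<noteq> (\<lambda>_. 0) \<and> (\<forall>w\<in>W. quiet b w)"
  using assms
proof (induction W rule: finite_induct)
  case empty
  show ?case using exists_rooted by simp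
next
  case (insert v W)
  then obtain b where b: "rooted b" "b \<noteq> (\<lambda>_. 0)" "\<forall>w\<in>W. quiet b w" by auto
  have fin: "finsupp b" using b(1) by (simp add: rooted_def)
  define b' where "b' t = b (t + v) - b t" for t
  have "b' \<noteq> (\<lambda>_. 0)"
  proof
    assume "b' = (\<lambda>_. 0)"
    then have "b' t = 0" for t by (simp only:)
    then have "b (t + v) = b t" for t by (simp add: b'_def)
    then show False using finsupp_shift_invariant[OF fin, of v] insert.prems b(2) by auto
  qed
  moreover have "rooted b'" unfolding b'_def using b(1) by (rule rooted_diff)
  moreover have "quiet b' w" if "w \<in> W" for w
    unfolding b'_def using quiet_diff[OF fin] b(3) that by blast
  moreover have "quiet b' v"
    unfolding b'_def quiet_def using germ_commutator[OF b(1)] by blast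
  ultimately show ?case by blast
qed

lemma germ_top_multiple:
  assumes "germ (top_act (a, b)) x x k"
  shows "germ (top_act (z * a, z * b)) x x (z * k)"
proof -
  have nat: "germ (top_act (int n * a, int n * b)) x x (int n * k)" for n
  proof (induction n)
    case 0
    show ?case using top_0 by (auto simp: germ_def zero_prod_def intro: exI[of _ 1])
  next
    case (Suc n)
    have "top_act (a, b) \<circ> top_act (int n * a, int n * b) = top_act (int (Suc n) * a, int (Suc n) * b)"
      by (auto simp: top_add algebra_simps)
    then show ?case using germ_comp[OF Suc assms] by (simp add: algebra_simps)
  qed
  show ?thesis
  proof (cases "z \<ge> 0")
    case True
    then show ?thesis using nat[of "nat z"] by simp
  next
    case False
    then have "germ (top_act (- z * a, - z * b)) x x (- z * k)" using nat[of "nat (- z)"] by simp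
    then have "germ (top_act (- (- z * a, - z * b))) x x (- (- z * k))"
      by (rule germ_inverse) (rule top_uminus)
    then show ?thesis by simp
  qed
qed

text \<open>Let \<open>s\<close> and \<open>t\<close> be powers of the two generators of the top group that have fixed points. If their
  slopes at a departure of \<open>s\<close> are \<open>2\<^sup>i\<close> and \<open>2\<^sup>j\<close>, then \<open>s\<^sup>jt\<^sup>-\<^sup>i\<close> has slope 1 there, so it fixes all points
  that \<open>s\<close> moves and that have this departure as the next one on their left. It is not trivial,
  because \<open>i \<noteq> 0\<close> at a departure.\<close>

lemma finite_stabilizer_cover:
  obtains W where "finite W" "0 \<notin> W" "\<And>p. \<exists>w\<in>W. top_act w p = p"
proof -
  obtain n q where n: "n > 0" "(top_act (1, 0) ^^ n) q = q"
    using thompson_has_periodic_point[OF top_in_T] .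
  obtain m r where m: "m > 0" "(top_act (0, 1) ^^ m) r = r"
    using thompson_has_periodic_point[OF top_in_T] .
  define s where "s = (int n, 0 :: int)"
  define t where "t = (0 :: int, int m)"
  have sq: "top_act s q = q" using n(2) by (simp add: top_pow s_def)
  have tr: "top_act t r = r" using m(2) by (simp add: top_pow t_def)
  have "\<exists>w. w \<noteq> 0 \<and> (\<forall>c. to_circle c = p \<longrightarrow> germ (top_act w) c c 0)"
    if p: "p \<in> departures (top_act s)" for p
  proof -
    obtain x where x: "p = to_circle x" by (rule to_circle_cases)
    have "top_act t p = p"
      using commuting_fixes_departures[OF top_in_T sq top_in_T tr top_commute p] .
    then obtain j where j: "germ (top_act (0, int m)) x x j"
      using germ_exists[OF top_in_T] x unfolding t_def by metis
    have "top_act s p = p" using p by (simp add: departures_def)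
    then obtain i where i: "germ (top_act (int n, 0)) x x i"
      using germ_exists[OF top_in_T] x unfolding s_def by metis
    have "i \<noteq> 0" using i p by (auto simp: x s_def to_circle_in_departures)
    define w where "w = (j * int n, - i * int m)"
    have "germ (top_act (j * int n, j * 0) \<circ> top_act (- i * 0, - i * int m)) x x (- i * j + j * i)"
      using germ_comp[OF germ_top_multiple[OF j] germ_top_multiple[OF i]] .
    moreover have "top_act (j * int n, j * 0) \<circ> top_act (- i * 0, - i * int m) = top_act w"
      by (auto simp: top_add w_def)
    ultimately have "germ (top_act w) x x 0" by simp
    then have "germ (top_act w) c c 0" if "to_circle c = p" for c
      using germ_translate[of "top_act w" x x 0] that x by (auto simp: to_circle_eq_iff)
    moreover have "w \<noteq> 0" using \<open>i \<noteq> 0\<close> m(1) by (auto simp: w_def zero_prod_def)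
    ultimately show ?thesis by blast
  qed
  then obtain w where w: "\<And>p. p \<in> departures (top_act s) \<Longrightarrow> w p \<noteq> 0"
    "\<And>c. to_circle c \<in> departures (top_act s) \<Longrightarrow> germ (top_act (w (to_circle c))) c c 0"
    by metis
  define W where "W = insert s (w ` departures (top_act s))"
  have "finite W" unfolding W_def using finite_departures[OF top_in_T sq] by simp
  moreover have "0 \<notin> W" using w(1) n(1) by (force simp: W_def s_def zero_prod_def)
  moreover have "\<exists>w\<in>W. top_act w p = p" for p
  proof (cases "top_act s p = p")
    case False
    then obtain c where "to_circle c \<in> departures (top_act s)"
      "\<And>v. (\<And>r. v (top_act s r) = top_act s (v r)) \<Longrightarrow> germ v c c 0 \<Longrightarrow> v p = p"
      using departure_controls_centralizer[OF top_in_T sq] by metis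
    then show ?thesis using w(2) top_commute unfolding W_def by blast
  qed (auto simp: W_def)
  ultimately show ?thesis by (rule that)
qed

lemma no_embedding: False
proof -
  obtain W where W: "finite W" "0 \<notin> W" "\<And>p. \<exists>w\<in>W. top_act w p = p"
    using finite_stabilizer_cover by metis
  obtain b where b: "rooted b" "b \<noteq> (\<lambda>_. 0)" "\<forall>w\<in>W. quiet b w"
    using exists_quiet[OF W(1,2)] by blast
  then obtain q where q: "finsupp b" "base_act b q = q" by (auto simp: rooted_def)
  obtain p where p: "p \<in> departures (base_act b)"
    using departures_nonempty[OF base_in_T[OF q(1)] q(2) base_nontrivial[OF q(1) b(2)]] by blast
  obtain x where x: "p = to_circle x" by (rule to_circle_cases)
  have "p \<in> common_fixed" using rooted_fixes_departures[OF b(1) _ p] by (simp add: common_fixed_def)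
  moreover obtain w where "w \<in> W" "top_act w p = p" using W(3) by blast
  ultimately have "germ (base_act b) x x 0" using b(3) x by (auto simp: quiet_def)
  then show False using p x by (simp add: to_circle_in_departures)
qed

end

theorem corollary1p5: "\<not> (\<exists>\<phi>. \<phi> \<in> mon ZW2 thompson_T)"
proof
  assume "\<exists>\<phi>. \<phi> \<in> mon ZW2 thompson_T"
  then obtain \<phi> where "\<phi> \<in> mon ZW2 thompson_T" ..
  then interpret ZW2_in_thompson \<phi> by unfold_locales
  show False by (rule no_embedding)
qed

end
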